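(* For every $\varepsilon\in(0,2/5)$ there is a randomized algorithm which, for maximizing a non-negative (possibly non-monotone) submodular function $f$ on an $n$-element ground set subject to a cardinality constraint $|T|\le k$, achieves a $(5.83+\varepsilon)$-approximation using $O(\frac{1}{\varepsilon}\log n)$ adaptive rounds and $O(\frac{nk}{\varepsilon^3}\log n\log k\log\frac{1}{\varepsilon})$ value queries; and there is also such a $(5.83+\varepsilon)$-approximation algorithm using $O(\frac{1}{\varepsilon}\log n\log k)$ adaptive rounds and $O(\frac{n}{\varepsilon^3}\log n\log^2 k\log\frac{1}{\varepsilon})$ value queries.
   Context: Problem setting: $\mathcal{N}$ is a finite ground set with $|\mathcal{N}|=n$; $f:2^{\mathcal{N}}\to\mathbb{R}$ is non-negative and submodular (not necessarily monotone), i.e. $f(S)\ge 0$ and $f(S\cup\{x\})-f(S)\ge f(T\cup\{x\})-f(T)$ for $S\subseteq T$, $x\notin T$. Given an integer $k\ge1$, let $OPT=\max\{f(T): T\subseteq\mathcal{N}, |T|\le k\}$; a randomized algorithm is a $\beta$-approximation if $\beta\cdot\mathbb{E}[f(\text{output})]\ge OPT$ and its output always has at most $k$ elements. The function $f$ is accessed only through a value oracle returning $f(S)$; query complexity is the total number of oracle calls, and adaptive complexity is the number of sequential rounds, where in each round polynomially many queries are issued in parallel and may depend only on answers from earlier rounds. *)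

theory Defs
  imports "HOL-Probability.Probability" "HOL-Computational_Algebra.Polynomial"
begin

definition nonneg_on :: "'a set \<Rightarrow> ('a set \<Rightarrow> real) \<Rightarrow> bool" where
  "nonneg_on N f \<longleftrightarrow> (\<forall>S. S \<subseteq> N \<longrightarrow> f S \<ge> 0)"

definition submodular_on :: "'a set \<Rightarrow> ('a set \<Rightarrow> real) \<Rightarrow> bool" where
  "submodular_on N f \<longleftrightarrow>
     (\<forall>S T x. S \<subseteq> T \<and> T \<subseteq> N \<and> x \<in> N \<and> x \<notin> T \<longrightarrow>
        f (S \<union> {x}) - f S \<ge> f (T \<union> {x}) - f T)"

definition OPT :: "'a set \<Rightarrow> nat \<Rightarrow> ('a set \<Rightarrow> real) \<Rightarrow> real" where
  "OPT N k f = Max (f ` {T. T \<subseteq> N \<and> card T \<le> k})"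

text \<open>
  Randomized algorithms with access to a value oracle. The tree does not mention \<open>f\<close>: all
  knowledge about \<open>f\<close> comes from the answers fed to the continuation of \<open>Query\<close>. One \<open>Query\<close>
  node is one adaptive round: the whole list of queries is fixed before any of its answers is
  seen. \<open>Flip\<close> makes a random choice and costs nothing; computation between the rounds
  is not charged.
\<close>

datatype ('a, 'r) oracle_alg =
    Return 'r
  | Flip "('a, 'r) oracle_alg pmf"
  | Query "'a set list" "real list \<Rightarrow> ('a, 'r) oracle_alg"

text \<open>
  Joint distribution of the output and the transcript, which lists the queries round by round.
\<close>

primrec exec :: "('a set \<Rightarrow> real) \<Rightarrow> ('a, 'r) oracle_alg \<Rightarrow> ('r \<times> 'a set list list) pmf" where
  "exec f (Return r) = return_pmf (r, [])"
| "exec f (Flip p) = join_pmf (map_pmf (exec f) p)"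
| "exec f (Query qs c) = map_pmf (\<lambda>(r, tr). (r, qs # tr)) (exec f (c (map f qs)))"

type_synonym 'a subset_alg = "'a set \<Rightarrow> nat \<Rightarrow> ('a, 'a set) oracle_alg"

definition instance_of :: "'a set \<Rightarrow> nat \<Rightarrow> ('a set \<Rightarrow> real) \<Rightarrow> bool" where
  "instance_of N k f \<longleftrightarrow> finite N \<and> k \<ge> 1 \<and> nonneg_on N f \<and> submodular_on N f"

definition approximation_alg :: "real \<Rightarrow> 'a subset_alg \<Rightarrow> bool" where
  "approximation_alg \<beta> A \<longleftrightarrow>
     (\<forall>N k f. instance_of N k f \<longrightarrow>
        (\<forall>(S, tr) \<in> set_pmf (exec f (A N k)). S \<subseteq> N \<and> card S \<le> k) \<and>
        \<beta> * measure_pmf.expectation (exec f (A N k)) (\<lambda>(S, tr). f S) \<ge> OPT N k f)"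

text \<open>
  The oracle is only defined on subsets of the ground set, and only polynomially many queries
  may be issued within a single round.
\<close>

definition admissible_rounds :: "'a subset_alg \<Rightarrow> bool" where
  "admissible_rounds A \<longleftrightarrow>
     (\<exists>p :: real poly. \<forall>N k f. instance_of N k f \<longrightarrow>
        (\<forall>(S, tr) \<in> set_pmf (exec f (A N k)). \<forall>qs \<in> set tr.
           set qs \<subseteq> Pow N \<and> real (length qs) \<le> poly p (real (card N))))"

definition adaptive_rounds_le :: "'a subset_alg \<Rightarrow> (nat \<Rightarrow> nat \<Rightarrow> real) \<Rightarrow> bool" where
  "adaptive_rounds_le A R \<longleftrightarrow>
     (\<forall>N k f. instance_of N k f \<longrightarrow>
        (\<forall>(S, tr) \<in> set_pmf (exec f (A N k)). real (length tr) \<le> R (card N) k))"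

definition value_queries_le :: "'a subset_alg \<Rightarrow> (nat \<Rightarrow> nat \<Rightarrow> real) \<Rightarrow> bool" where
  "value_queries_le A Q \<longleftrightarrow>
     (\<forall>N k f. instance_of N k f \<longrightarrow>
        (\<forall>(S, tr) \<in> set_pmf (exec f (A N k)). real (length (concat tr)) \<le> Q (card N) k))"

text \<open>
  The logarithm inside \<open>O\<close>-bounds. It is the binary logarithm for \<open>x \<ge> 2\<close>; the cut-off keeps
  the bounds meaningful for \<open>k = 1\<close> and \<open>n = 1\<close>, where a literal \<open>log k = 0\<close> would forbid any query.
\<close>

definition lg :: "real \<Rightarrow> real" where
  "lg x = max 1 (log 2 x)"

end

theory Submission
  imports Defs
begin

text \<open>
  A constant ratio below \<open>5.83\<close> suffices, so all precision parameters are fixed numbers and one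
  algorithm serves both claims. It scans geometrically decreasing thresholds, starting from a guess
  of the order of \<open>10 OPT / k\<close>; the \<open>O(log k)\<close> guesses run in parallel. At a threshold \<open>\<theta>\<close>, an
  undecided element whose marginal value is at least \<open>\<theta>\<close> is a candidate. A round draws a random
  sequence of a tenth of the candidates, each with a fair coin, and accepts those whose coin shows
  heads, until more than a tenth of the candidates have dropped below \<open>\<theta>\<close>. This is tested only at
  \<open>O(log k)\<close> prefixes, which costs \<open>O(n log k)\<close> queries, and a threshold is exhausted after
  \<open>O(log n)\<close> rounds.

  Let \<open>S\<close> be the accepted set and \<open>T\<close> an optimal set. Every element enters \<open>S\<close> with probability at
  most \<open>1/2\<close>, hence \<open>E f(S \<union> T) \<ge> f(T) / 2\<close>. By submodularity \<open>f(S \<union> T) - f(S)\<close> is at most the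
  sum of the marginal values of \<open>T - S\<close>: those rejected by their coin are matched, on average, by
  the accepted elements of \<open>T\<close>, and those never considered by the accepted elements outside \<open>T\<close>,
  since thresholds decrease. So \<open>E f(S \<union> T)\<close> is roughly at most \<open>2 E f(S)\<close>, which gives a ratio close
  to \<open>4\<close>. The output keeps only those accepted elements whose marginal value reached the threshold
  when they were drawn, which makes negative marginal values harmless.
\<close>

section \<open>Submodular functions\<close>

definition marg :: "('a set \<Rightarrow> real) \<Rightarrow> 'a set \<Rightarrow> 'a \<Rightarrow> real" where
  "marg f S x = f (insert x S) - f S"

locale submodular_instance =
  fixes N :: "'a set" and f :: "'a set \<Rightarrow> real"
  assumes finite_ground: "finite N"
    and nonneg: "S \<subseteq> N \<Longrightarrow> 0 \<le> f S"
    and submodular: "submodular_on N f"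
begin

lemma marg_antimono:
  assumes "S \<subseteq> T" "T \<subseteq> N" "x \<in> N" "x \<notin> T"
  shows "marg f T x \<le> marg f S x"
  using submodular assms unfolding submodular_on_def marg_def by (metis Un_insert_right sup_bot_right)

text \<open>Adding the elements of \<open>B\<close> one at a time reduces this to
  \<open>marg_antimono\<close>; as \<open>B\<close> is disjoint from \<open>C\<close>, each new
  element lies outside the larger set.\<close>

lemma gain_antimono:
  assumes "A \<subseteq> C" "C \<subseteq> N" "B \<subseteq> N" "B \<inter> C = {}"
  shows "f (C \<union> B) - f C \<le> f (A \<union> B) - f A"
proof -
  have "finite B" using assms(3) finite_ground finite_subset by blast
  then show ?thesis using assms(3,4)
  proof (induction B)
    case (insert x B)
    have "marg f (C \<union> B) x \<le> marg f (A \<union> B) x"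
      using insert assms(1,2) by (intro marg_antimono) auto
    with insert show ?case by (simp add: marg_def)
  qed simp
qed

lemma union_le_sum_marg:
  assumes "A \<subseteq> N" "B \<subseteq> N" "A \<inter> B = {}"
  shows "f (A \<union> B) \<le> f A + (\<Sum>b\<in>B. marg f A b)"
proof -
  have "finite B" using assms(2) finite_ground finite_subset by blast
  then show ?thesis using assms(2,3)
  proof (induction B)
    case (insert x B)
    have "marg f (A \<union> B) x \<le> marg f A x"
      using insert assms(1) by (intro marg_antimono) auto
    with insert show ?case by (simp add: marg_def)
  qed simp
qed

text \<open>The gain of \<open>B - A\<close> over \<open>A\<close> is at most its gain over
  \<open>A \<inter> B\<close>, which is \<open>f B - f (A \<inter> B)\<close>; nonnegativity
  discards the subtracted value.\<close>

lemma subadditive: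
  assumes "A \<subseteq> N" "B \<subseteq> N"
  shows "f (A \<union> B) \<le> f A + f B"
proof -
  have "f (A \<union> (B - A)) - f A \<le> f (A \<inter> B \<union> (B - A)) - f (A \<inter> B)"
    using assms by (intro gain_antimono) auto
  moreover have "A \<inter> B \<union> (B - A) = B" "A \<union> (B - A) = A \<union> B" by auto
  moreover have "0 \<le> f (A \<inter> B)" using assms by (intro nonneg) auto
  ultimately show ?thesis by simp
qed

end

section \<open>Histories\<close>

text \<open>
  An entry \<open>(x, c, m, \<theta>)\<close> says that \<open>x\<close> was considered at threshold \<open>\<theta>\<close>, that its coin showed
  \<open>c\<close>, and that its marginal value with respect to the elements chosen before was \<open>m\<close>. The newest
  entry comes first.
\<close>

type_synonym 'a history = "('a \<times> bool \<times> real \<times> real) list"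

fun chosen :: "'a history \<Rightarrow> 'a set" where
  "chosen [] = {}"
| "chosen ((x, c, m, \<theta>) # h) = (if c then insert x (chosen h) else chosen h)"

fun kept :: "'a history \<Rightarrow> 'a set" where
  "kept [] = {}"
| "kept ((x, c, m, \<theta>) # h) = (if c \<and> \<theta> \<le> m then insert x (kept h) else kept h)"

definition seen :: "'a history \<Rightarrow> 'a set" where
  "seen h = fst ` set h"

definition thresholds :: "'a history \<Rightarrow> real set" where
  "thresholds h = (\<lambda>(x, c, m, \<theta>). \<theta>) ` set h"

definition hsum :: "('a \<Rightarrow> bool \<Rightarrow> real \<Rightarrow> real \<Rightarrow> real) \<Rightarrow> 'a history \<Rightarrow> real" where
  "hsum \<phi> h = (\<Sum>(x, c, m, \<theta>) \<leftarrow> h. \<phi> x c m \<theta>)"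

fun valid_history :: "'a set \<Rightarrow> ('a set \<Rightarrow> real) \<Rightarrow> 'a history \<Rightarrow> bool" where
  "valid_history N f [] = True"
| "valid_history N f ((x, c, m, \<theta>) # h) \<longleftrightarrow>
     x \<in> N \<and> x \<notin> seen h \<and> m = marg f (chosen h) x \<and> valid_history N f h"

lemma seen_simps [simp]: "seen [] = {}" "seen (e # h) = insert (fst e) (seen h)"
  by (auto simp: seen_def)

lemma thresholds_simps [simp]:
  "thresholds [] = {}" "thresholds ((x, c, m, \<theta>) # h) = insert \<theta> (thresholds h)"
  by (auto simp: thresholds_def)

lemma hsum_simps [simp]:
  "hsum \<phi> [] = 0" "hsum \<phi> ((x, c, m, \<theta>) # h) = \<phi> x c m \<theta> + hsum \<phi> h"
  by (auto simp: hsum_def)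

lemma kept_subset_chosen: "kept h \<subseteq> chosen h"
  by (induction h rule: kept.induct) auto

lemma chosen_subset_seen: "chosen h \<subseteq> seen h"
  by (induction h rule: chosen.induct) auto

lemma finite_chosen [simp]: "finite (chosen h)"
  by (induction h rule: chosen.induct) auto

lemma valid_seen_subset: "valid_history N f h \<Longrightarrow> seen h \<subseteq> N"
  by (induction N f h rule: valid_history.induct) auto

lemma hsum_mono:
  assumes "\<And>x c m \<theta>. (x, c, m, \<theta>) \<in> set h \<Longrightarrow> \<phi> x c m \<theta> \<le> \<psi> x c m \<theta>"
  shows "hsum \<phi> h \<le> hsum \<psi> h"
  using assms unfolding hsum_def by (intro sum_list_mono) auto

lemma hsum_add: "hsum (\<lambda>x c m \<theta>. \<phi> x c m \<theta> + \<psi> x c m \<theta>) h = hsum \<phi> h + hsum \<psi> h"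
  by (induction h) (auto simp: hsum_def)

lemma hsum_cmult: "hsum (\<lambda>x c m \<theta>. a * \<phi> x c m \<theta>) h = a * hsum \<phi> h"
  by (induction h) (auto simp: hsum_def algebra_simps)

text \<open>Each element of \<open>A\<close> is paid for by its own entry, and the remaining entries
  contribute nonnegative amounts. With \<open>A = {}\<close> this gives nonnegativity of
  \<open>hsum\<close>.\<close>

lemma sum_le_hsum:
  assumes "valid_history N f h" "A \<subseteq> seen h"
    and "\<And>x c m \<theta>. (x, c, m, \<theta>) \<in> set h \<Longrightarrow> 0 \<le> \<phi> x c m \<theta>"
    and "\<And>x c m \<theta>. (x, c, m, \<theta>) \<in> set h \<Longrightarrow> x \<in> A \<Longrightarrow> g x \<le> \<phi> x c m \<theta>"
  shows "(\<Sum>x\<in>A. g x) \<le> hsum \<phi> h"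
  using assms
proof (induction N f h arbitrary: A rule: valid_history.induct)
  case (2 N f x c m \<theta> h)
  have *: "(\<Sum>x\<in>A - {x}. g x) \<le> hsum \<phi> h"
    using 2 by (intro 2(1)) auto
  have "finite A" using 2(3) by (rule finite_subset) (simp add: seen_def)
  then have "(\<Sum>x\<in>A. g x) \<le> \<phi> x c m \<theta> + (\<Sum>x\<in>A - {x}. g x)"
    using 2(4,5)[of x c m \<theta>] by (cases "x \<in> A") (auto simp: sum.remove)
  with * show ?case by simp
qed auto

context submodular_instance
begin

lemma valid_chosen_subset: "valid_history N f h \<Longrightarrow> chosen h \<subseteq> N"
  using chosen_subset_seen valid_seen_subset by fast

lemma valid_kept_subset: "valid_history N f h \<Longrightarrow> kept h \<subseteq> N"
  using kept_subset_chosen valid_chosen_subset by fast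

lemma value_chosen:
  "valid_history N f h \<Longrightarrow> f (chosen h) = f {} + hsum (\<lambda>x c m \<theta>. if c then m else 0) h"
  by (induction N f h rule: valid_history.induct) (auto simp: marg_def)

text \<open>An element is recorded with its marginal value over \<open>chosen\<close>. Over the
  smaller set \<open>kept\<close> its marginal value is at least as large, so dropping the poor
  elements never hurts the others.\<close>

lemma value_kept:
  "valid_history N f h \<Longrightarrow>
     f {} + hsum (\<lambda>x c m \<theta>. if c \<and> \<theta> \<le> m then m else 0) h \<le> f (kept h)"
proof (induction h)
  case (Cons e h)
  obtain x c m \<theta> where e: "e = (x, c, m, \<theta>)" by (cases e)
  have "marg f (chosen h) x \<le> marg f (kept h) x"
    using Cons.prems e kept_subset_chosen[of h] chosen_subset_seen[of h] valid_chosen_subset[of h]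
    by (intro marg_antimono) auto
  with Cons e show ?case by (auto simp: marg_def)
qed simp

text \<open>Later acceptances can only lower a marginal value. If the entry of \<open>x\<close> is
  the newest one, \<open>x\<close> was rejected and the chosen set has not changed since.\<close>

lemma marg_recorded:
  "valid_history N f h \<Longrightarrow> (x, c, m, \<theta>) \<in> set h \<Longrightarrow> x \<notin> chosen h \<Longrightarrow> marg f (chosen h) x \<le> m"
proof (induction h)
  case (Cons e h)
  obtain y d m' \<theta>' where e: "e = (y, d, m', \<theta>')" by (cases e)
  have valid: "valid_history N f h" and yN: "y \<in> N" using Cons.prems e by auto
  show ?case
  proof (cases "(x, c, m, \<theta>) \<in> set h")
    case True
    then have "x \<in> seen h" by (force simp: seen_def)
    then have xN: "x \<in> N" using valid_seen_subset[OF valid] by auto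
    have x: "x \<notin> chosen h" using Cons.prems(3) e by (auto split: if_splits)
    have "marg f (chosen (e # h)) x \<le> marg f (chosen h) x"
      using Cons.prems(3) e xN yN valid_chosen_subset[OF valid]
      by (intro marg_antimono) (auto split: if_splits)
    with Cons.IH[OF valid True x] show ?thesis by simp
  next
    case False
    with Cons.prems e show ?thesis by auto
  qed
qed simp

end

section \<open>Random batches\<close>

text \<open>
  The numbers of elements accepted within a batch at which the candidates are tested again. Only
  \<open>O(log k)\<close> of them are at most \<open>k\<close>, but the last one below \<open>a\<close> misses \<open>a\<close> by at most a fraction
  \<open>1/16\<close>.
\<close>

definition grid :: "nat set" where
  "grid = {a. \<exists>m\<le>32. \<exists>e. a = m * 2 ^ e}"

text \<open>Numbers below 16 are grid points. Otherwise \<open>a\<close> is rounded down to a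
  multiple of \<open>2 ^ e\<close>, where \<open>16 * 2 ^ e \<le> a < 32 * 2 ^ e\<close>.\<close>

lemma ex_grid_close: "\<exists>g\<in>grid. g \<le> a \<and> 16 * (a - g) \<le> a"
proof (cases "a < 16")
  case True
  have "a \<in> grid" unfolding grid_def using True by (intro CollectI exI[of _ a] conjI exI[of _ 0]) auto
  then show ?thesis by force
next
  case False
  then have "1 \<le> a div 16" by linarith
  then obtain e where "2 ^ e \<le> a div 16" "a div 16 < 2 ^ (e + 1)"
    using ex_power_ivl1[of 2 "a div 16"] by auto
  then have e: "16 * 2 ^ e \<le> a" "a < 32 * 2 ^ e"
    by (linarith, simp add: div_less_iff_less_mult)
  define m where "m = a div 2 ^ e"
  have "m \<le> 32" using e(2) unfolding m_def by (simp add: less_mult_imp_div_less less_imp_le)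
  then have "m * 2 ^ e \<in> grid" unfolding grid_def by blast
  moreover have "m * 2 ^ e \<le> a" unfolding m_def by simp
  moreover have "a - m * 2 ^ e < 2 ^ e" unfolding m_def
    by (simp add: minus_div_mult_eq_mod)
  ultimately show ?thesis using e(1) by (intro bexI[of _ "m * 2 ^ e"]) auto
qed

text \<open>A nonzero grid point up to \<open>k\<close> has an exponent of at most
  \<open>log 2 k\<close>, and there are 33 multipliers.\<close>

lemma card_grid_le:
  assumes "1 \<le> k"
  shows "real (card (grid \<inter> {..k})) \<le> 66 * lg k"
proof -
  define L where "L = nat \<lfloor>log 2 k\<rfloor>"
  have "grid \<inter> {..k} \<subseteq> (\<lambda>(m, e). m * 2 ^ e) ` ({..32} \<times> {..L})"
  proof
    fix a assume a: "a \<in> grid \<inter> {..k}"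
    then obtain m e where me: "m \<le> 32" "a = m * 2 ^ e" "a \<le> k" by (auto simp: grid_def)
    show "a \<in> (\<lambda>(m, e). m * 2 ^ e) ` ({..32} \<times> {..L})"
    proof (cases "m = 0")
      case True
      then show ?thesis using me by (auto intro!: image_eqI[of _ _ "(0, 0)"])
    next
      case False
      then have "2 ^ e \<le> k" using me by (metis One_nat_def Suc_leI le_trans mult_le_mono1 nat_mult_1 neq0_conv)
      then have "real e \<le> log 2 k" using assms by (simp add: le_log2_of_power)
      then have "e \<le> L" unfolding L_def by linarith
      with me show ?thesis by force
    qed
  qed
  then have "card (grid \<inter> {..k}) \<le> card ((\<lambda>(m, e). m * 2 ^ e :: nat) ` ({..32} \<times> {..L}))"
    by (intro card_mono) auto
  also have "\<dots> \<le> card ({..32::nat} \<times> {..L})" by (intro card_image_le) auto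
  also have "\<dots> = 33 * (L + 1)" by simp
  finally have "real (card (grid \<inter> {..k})) \<le> real (33 * (L + 1))" by (simp only: of_nat_le_iff)
  moreover have "real L \<le> log 2 k" unfolding L_def using assms by simp
  ultimately show ?thesis unfolding lg_def by (simp add: max_def)
qed

section \<open>The random process for a single guess\<close>

primrec draws :: "nat \<Rightarrow> 'a set \<Rightarrow> ('a \<times> bool) list pmf" where
  "draws 0 P = return_pmf []"
| "draws (Suc l) P =
     pmf_of_set (P \<times> UNIV) \<bind> (\<lambda>(x, c). map_pmf ((#) (x, c)) (draws l (P - {x})))"

text \<open>\<open>a\<close> counts the acceptances of the current batch. Counting the candidates
  below \<theta> takes a query per candidate, so it is done at grid points only.\<close>

definition stop :: "('a set \<Rightarrow> real) \<Rightarrow> nat \<Rightarrow> 'a set \<Rightarrow> real \<Rightarrow> nat \<Rightarrow> 'a set \<Rightarrow> bool" where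
  "stop f k X \<theta> a S \<longleftrightarrow>
     k \<le> card S \<or> a \<in> grid \<and> card X < 10 * card {x \<in> X. marg f S x < \<theta>}"

text \<open>Until the walk stops, acceptance depends on the coin alone and marginal values are
  merely recorded. Hence the draws determine all sets that can be visited, and their values can be
  requested in a single round.\<close>

fun walk :: "('a set \<Rightarrow> real) \<Rightarrow> nat \<Rightarrow> 'a set \<Rightarrow> real \<Rightarrow> nat \<Rightarrow> 'a history \<Rightarrow>
    ('a \<times> bool) list \<Rightarrow> 'a history" where
  "walk f k X \<theta> a h [] = h"
| "walk f k X \<theta> a h ((x, c) # xs) =
     (if stop f k X \<theta> a (chosen h) then h
      else walk f k X \<theta> (if c then Suc a else a) ((x, c, marg f (chosen h) x, \<theta>) # h) xs)"

definition candidates :: "('a set \<Rightarrow> real) \<Rightarrow> 'a set \<Rightarrow> real \<Rightarrow> 'a history \<Rightarrow> 'a set" where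
  "candidates f N \<theta> h = {x \<in> N - seen h. \<theta> \<le> marg f (chosen h) x}"

text \<open>A tenth rounded up, so that a batch drawn to its end uses up at least a tenth of the
  candidates.\<close>

definition batch_size :: "'a set \<Rightarrow> nat" where
  "batch_size X = (card X + 9) div 10"

primrec rounds :: "('a set \<Rightarrow> real) \<Rightarrow> 'a set \<Rightarrow> nat \<Rightarrow> real list \<Rightarrow> 'a history \<Rightarrow> 'a history pmf" where
  "rounds f N k [] h = return_pmf h"
| "rounds f N k (\<theta> # \<theta>s) h =
     draws (batch_size (candidates f N \<theta> h)) (candidates f N \<theta> h) \<bind>
       (\<lambda>xs. rounds f N k \<theta>s (walk f k (candidates f N \<theta> h) \<theta> 0 h xs))"

lemma set_pmf_draws:
  assumes "finite P" "l \<le> card P" "xs \<in> set_pmf (draws l P)"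
  shows "length xs = l" "distinct (map fst xs)" "fst ` set xs \<subseteq> P"
proof -
  have "length xs = l \<and> distinct (map fst xs) \<and> fst ` set xs \<subseteq> P"
    using assms
  proof (induction l arbitrary: P xs)
    case (Suc l)
    have ne: "P \<noteq> {}" using Suc.prems by auto
    obtain x c ys where xs: "xs = (x, c) # ys" "x \<in> P" "ys \<in> set_pmf (draws l (P - {x}))"
      using Suc.prems(3) ne Suc.prems(1) by (auto simp: set_pmf_of_set)
    have "length ys = l \<and> distinct (map fst ys) \<and> fst ` set ys \<subseteq> P - {x}"
      using Suc.prems xs by (intro Suc.IH) auto
    with xs show ?case by auto
  qed simp
  then show "length xs = l" "distinct (map fst xs)" "fst ` set xs \<subseteq> P" by auto
qed

lemma finite_set_pmf_draws:
  assumes "finite P" "l \<le> card P"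
  shows "finite (set_pmf (draws l P))"
proof (rule finite_subset)
  show "set_pmf (draws l P) \<subseteq> {xs. set xs \<subseteq> P \<times> UNIV \<and> length xs = l}"
    using set_pmf_draws[OF assms] by force
  show "finite {xs. set xs \<subseteq> P \<times> (UNIV :: bool set) \<and> length xs = l}"
    using assms by (intro finite_lists_length_eq) auto
qed

lemma batch_size_le: "batch_size X \<le> card X"
  unfolding batch_size_def by linarith

lemma expectation_draws_Suc:
  fixes F :: "('a \<times> bool) list \<Rightarrow> real"
  assumes "finite P" "Suc l \<le> card P"
  shows "measure_pmf.expectation (draws (Suc l) P) F =
    (\<Sum>x\<in>P. (measure_pmf.expectation (draws l (P - {x})) (\<lambda>xs. F ((x, True) # xs)) +
              measure_pmf.expectation (draws l (P - {x})) (\<lambda>xs. F ((x, False) # xs))) / 2) / card P"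
proof -
  have ne: "P \<noteq> {}" using assms by auto
  have "measure_pmf.expectation (draws (Suc l) P) F =
    (\<Sum>(x, c)\<in>P \<times> UNIV. measure_pmf.expectation (draws l (P - {x})) (\<lambda>xs. F ((x, c) # xs)) /\<^sub>R
        real (card (P \<times> (UNIV :: bool set))))"
    unfolding draws.simps using assms ne
    by (subst pmf_expectation_bind_pmf_of_set)
       (auto intro!: finite_set_pmf_draws sum.cong simp: case_prod_beta)
  also have "\<dots> = (\<Sum>x\<in>P. \<Sum>c\<in>UNIV. measure_pmf.expectation (draws l (P - {x})) (\<lambda>xs. F ((x, c) # xs)) /\<^sub>R
        real (card (P \<times> (UNIV :: bool set))))"
    by (rule sum.cartesian_product[symmetric])
  also have "\<dots> = (\<Sum>x\<in>P. (measure_pmf.expectation (draws l (P - {x})) (\<lambda>xs. F ((x, True) # xs)) +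
              measure_pmf.expectation (draws l (P - {x})) (\<lambda>xs. F ((x, False) # xs))) / 2) / card P"
  proof -
    have "v /\<^sub>R (n * 2) + u /\<^sub>R (n * 2) = (u + v) / 2 / n" for u v n :: real
      by (cases "n = 0") (simp_all add: field_simps)
    then show ?thesis
      by (simp add: UNIV_bool card_cartesian_product sum_divide_distrib del: divide_divide_eq_left real_scaleR_def)
  qed
  finally show ?thesis .
qed

section \<open>The potential\<close>

context submodular_instance
begin

text \<open>
  A lower bound for the expected final value of \<open>f (S \<union> T)\<close> if each element of \<open>U\<close> can still be
  accepted, but only by a fair coin.
\<close>

definition cover :: "'a set \<Rightarrow> 'a set \<Rightarrow> 'a set \<Rightarrow> real" where
  "cover T S U = (f (S \<union> T) + Min ((\<lambda>Z. f (S \<union> Z \<union> T)) ` Pow U)) / 2"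

lemma cover_le:
  assumes "U \<subseteq> N"
  shows "cover T S U \<le> f (S \<union> T)"
proof -
  have "finite U" using assms finite_ground finite_subset by blast
  then have "Min ((\<lambda>Z. f (S \<union> Z \<union> T)) ` Pow U) \<le> f (S \<union> {} \<union> T)"
    by (intro Min_le) (auto intro!: image_eqI[of _ _ "{}"])
  then show ?thesis by (simp add: cover_def)
qed

text \<open>The minimum is only known to be nonnegative; this is where half of \<open>f T\<close> is
  lost.\<close>

lemma cover_init:
  assumes "T \<subseteq> N"
  shows "f T / 2 \<le> cover T {} N"
proof -
  have "0 \<le> Min ((\<lambda>Z. f ({} \<union> Z \<union> T)) ` Pow N)"
    using finite_ground assms by (subst Min_ge_iff) (auto intro!: nonneg)
  then show ?thesis by (simp add: cover_def)
qed

text \<open>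
  With \<open>a\<close> and \<open>b\<close> the two minima on the right, submodularity bounds the marginal value of \<open>x\<close>
  from below by \<open>a - b\<close>, which compensates for the loss of the smaller minimum.
\<close>

lemma cover_step:
  assumes "S \<subseteq> N" "U \<subseteq> N" "T \<subseteq> N" "x \<in> U" "S \<inter> U = {}"
  shows "2 * cover T S U \<le> cover T (insert x S) (U - {x}) + cover T S (U - {x})"
proof -
  define F where "F = (\<lambda>S Z. f (S \<union> Z \<union> T))"
  define a where "a = Min (F (insert x S) ` Pow (U - {x}))"
  define b where "b = Min (F S ` Pow (U - {x}))"
  have finU: "finite U" using assms finite_ground finite_subset by blast
  have "b \<in> F S ` Pow (U - {x})" unfolding b_def using finU by (intro Min_in) auto
  then obtain Z0 where Z0: "Z0 \<subseteq> U - {x}" "b = F S Z0" by auto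
  have "a \<in> F (insert x S) ` Pow (U - {x})" unfolding a_def using finU by (intro Min_in) auto
  then obtain Z1 where Z1: "Z1 \<subseteq> U - {x}" "a = F (insert x S) Z1" by auto
  have "a \<le> F (insert x S) Z0" unfolding a_def using finU Z0(1) by (intro Min_le) auto
  moreover have "F (insert x S) Z0 - F S Z0 \<le> f (insert x S \<union> T) - f (S \<union> T)"
  proof (cases "x \<in> T")
    case True
    then have "insert x S \<union> Z0 \<union> T = S \<union> Z0 \<union> T" "insert x S \<union> T = S \<union> T" by auto
    then show ?thesis by (simp add: F_def)
  next
    case False
    have "marg f (S \<union> Z0 \<union> T) x \<le> marg f (S \<union> T) x"
      using assms Z0 False by (intro marg_antimono) auto
    then show ?thesis by (simp add: F_def marg_def)
  qed
  ultimately have gain: "a - b \<le> f (insert x S \<union> T) - f (S \<union> T)" using Z0 by simp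
  have "Min (F S ` Pow U) \<le> F S (insert x Z1)"
    using finU Z1(1) assms(4) by (intro Min_le) auto
  moreover have "F S (insert x Z1) = a" using Z1(2) by (simp add: F_def)
  ultimately have "Min (F S ` Pow U) \<le> a" by simp
  moreover have "cover T S U = (f (S \<union> T) + Min (F S ` Pow U)) / 2"
    "cover T S (U - {x}) = (f (S \<union> T) + b) / 2"
    "cover T (insert x S) (U - {x}) = (f (insert x S \<union> T) + a) / 2"
    by (simp_all add: cover_def F_def a_def b_def)
  ultimately show ?thesis using gain by argo
qed

end

text \<open>
  With fair coins the first summand vanishes on average. The second one charges accepted elements
  below their threshold against a \<open>25/144 = 1/9 + 1/16\<close> fraction of all accepted elements: \<open>1/9\<close>
  bounds their frequency while at most a tenth of the candidates is below the threshold, and \<open>1/16\<close>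
  comes from the grid.
\<close>

definition charge :: "'a set \<Rightarrow> 'a \<Rightarrow> bool \<Rightarrow> real \<Rightarrow> real \<Rightarrow> real" where
  "charge T x c m \<theta> =
     (if x \<in> T then (if c then max m \<theta> else - max m \<theta>) else 0) +
     (if c then 27 / 10 * (25 / 144 * \<theta> - (if m < \<theta> then \<theta> else 0)) else 0)"

text \<open>The grid point \<open>g\<close> close to \<open>a - 1\<close> satisfies
  \<open>d \<le> a - 1 - g\<close>, and this gap is at most \<open>(a - 1) / 16\<close>.\<close>

lemma overshoot_le:
  assumes "d \<le> a" "\<And>g. g \<in> grid \<Longrightarrow> g < a \<Longrightarrow> d + g + 1 \<le> a"
  shows "16 * d \<le> a"
proof (cases "a = 0")
  case False
  obtain g where "g \<in> grid" "g \<le> a - 1" "16 * (a - 1 - g) \<le> a - 1"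
    using ex_grid_close[of "a - 1"] by blast
  moreover from this have "d + g + 1 \<le> a" using assms(2) False by simp
  ultimately show ?thesis by arith
qed (use assms in simp)

context submodular_instance
begin

text \<open>Its expectation does not decrease over the rounds. It starts at \<open>f T / 2\<close>
  or more and ends bounded in terms of \<open>f (kept h)\<close>.\<close>

definition potential :: "'a set \<Rightarrow> 'a history \<Rightarrow> real" where
  "potential T h = cover T (chosen h) (N - seen h) + hsum (charge T) h"

text \<open>Summed over the two coin outcomes, \<open>cover\<close> does not drop by
  \<open>cover_step\<close> and the terms for \<open>x \<in> T\<close> cancel; what remains is the
  second summand of \<open>charge\<close> for heads.\<close>

lemma potential_step:
  assumes "valid_history N f h" "T \<subseteq> N" "x \<in> N - seen h" "m = marg f (chosen h) x"
  shows "2 * potential T h + 27 / 10 * (25 / 144 * \<theta> - (if m < \<theta> then \<theta> else 0))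
    \<le> potential T ((x, True, m, \<theta>) # h) + potential T ((x, False, m, \<theta>) # h)"
proof -
  have "2 * cover T (chosen h) (N - seen h) \<le>
      cover T (insert x (chosen h)) (N - seen h - {x}) + cover T (chosen h) (N - seen h - {x})"
    using assms valid_chosen_subset[OF assms(1)] chosen_subset_seen[of h]
    by (intro cover_step) auto
  moreover have "N - seen h - {x} = N - insert x (seen h)" by auto
  ultimately show ?thesis
    by (simp add: potential_def charge_def)
qed

text \<open>
  The number \<open>d\<close> counts the elements of the batch accepted while more than a tenth of \<open>X\<close> was
  already below the threshold. This can only happen after the last test that did not stop the
  batch, so \<open>d\<close> is at most \<open>a / 16\<close> by the choice of the grid.
\<close>

lemma expectation_potential_walk:
  assumes "valid_history N f h" "T \<subseteq> N" "X \<subseteq> N" "P \<subseteq> X - seen h" "0 < \<theta>"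
    and "9 * card X + 10 * l < 10 * card P + 10"
    and "d \<le> a" "\<And>g. g \<in> grid \<Longrightarrow> g < a \<Longrightarrow> d + g + 1 \<le> a"
    and "10 * card {x \<in> X. marg f (chosen h) x < \<theta>} \<le> card X \<Longrightarrow> d = 0"
  shows "potential T h + 27 / 10 * \<theta> * (real d - real a / 16)
    \<le> measure_pmf.expectation (draws l P) (\<lambda>xs. potential T (walk f k X \<theta> a h xs))"
  using assms
proof (induction l arbitrary: P h a d)
  case 0
  have "16 * d \<le> a" using 0(7,8) by (rule overshoot_le)
  then have "27 / 10 * \<theta> * (real d - real a / 16) \<le> 0"
    using 0(5) by (intro mult_nonneg_nonpos) auto
  then show ?case by simp
next
  case (Suc l)
  note valid = Suc.prems(1) and TN = Suc.prems(2) and XN = Suc.prems(3) and PX = Suc.prems(4)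
    and pos_\<theta> = Suc.prems(5) and size = Suc.prems(6)
  have "finite X" using XN finite_ground finite_subset by blast
  then have finP: "finite P" and PleX: "card P \<le> card X"
    using PX by (auto intro: finite_subset card_mono)
  \<comment> \<open>The size condition says that the pool \<open>P\<close> of undrawn candidates
    still exceeds nine tenths of \<open>X\<close>.\<close>
  have "10 * l < card P" using size PleX by simp
  then have lP: "Suc l \<le> card P" by simp
  define S where "S = chosen h"
  define bad where "bad = {x \<in> X. marg f S x < \<theta>}"
  define dirty where "dirty \<longleftrightarrow> card X < 10 * card bad"
  show ?case
  proof (cases "stop f k X \<theta> a S")
    case True
    have "walk f k X \<theta> a h xs = h" for xs
      using True by (cases xs; cases "hd xs") (auto simp: S_def)
    moreover have "16 * d \<le> a" using Suc.prems(7,8) by (rule overshoot_le)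
    then have "27 / 10 * \<theta> * (real d - real a / 16) \<le> 0"
      using pos_\<theta> by (intro mult_nonneg_nonpos) auto
    ultimately show ?thesis by simp
  next
    case False
    define d' where "d' = (if dirty then Suc d else d)"
    define b where "b = (\<lambda>x. if marg f S x < \<theta> then 1 else 0 :: real)"
    define E where "E = (\<lambda>x c. measure_pmf.expectation (draws l (P - {x}))
      (\<lambda>xs. potential T (walk f k X \<theta> a h ((x, c) # xs))))"
    define base where "base = potential T h + 27 / 10 * \<theta> * (real d - real a / 16)"
    \<comment> \<open>Heads earns 25/144 from \<open>charge\<close> and loses 1/16 through the
      larger \<open>a\<close>, which leaves 1/9; in a dirty state \<open>d\<close> grows too and
      adds 1. The factor is half of 27/10 since only one of the two outcomes accepts.\<close>
    have step: "base + 27 / 20 * \<theta> * (1 / 9 + (if dirty then 1 else 0) - b x) \<le> (E x True + E x False) / 2"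
      if x: "x \<in> P" for x
    proof -
      define m where "m = marg f S x"
      let ?h1 = "(x, True, m, \<theta>) # h" and ?h0 = "(x, False, m, \<theta>) # h"
      have size': "9 * card X + 10 * l < 10 * card (P - {x}) + 10"
        using size lP finP x by simp
      have v1: "valid_history N f ?h1" and v0: "valid_history N f ?h0"
        using valid PX XN x by (auto simp: m_def S_def)
      have "potential T ?h1 + 27 / 10 * \<theta> * (real d' - real (Suc a) / 16) \<le> E x True"
      proof -
        \<comment> \<open>A dirty state that does not stop the walk is off the grid, so grid points
          below \<open>Suc a\<close> are already below \<open>a\<close>.\<close>
        have notgrid: "a \<notin> grid" if dirty
          using that False by (auto simp: stop_def dirty_def bad_def)
        have clean: "d = 0" if "\<not> dirty"
          using that Suc.prems(9) by (auto simp: dirty_def bad_def S_def)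
        have "potential T ?h1 + 27 / 10 * \<theta> * (real d' - real (Suc a) / 16)
          \<le> measure_pmf.expectation (draws l (P - {x})) (\<lambda>xs. potential T (walk f k X \<theta> (Suc a) ?h1 xs))"
        proof (rule Suc.IH[OF v1 TN XN _ pos_\<theta> size'])
          show "P - {x} \<subseteq> X - seen ?h1" using PX by auto
          show "d' \<le> Suc a" using Suc.prems(7) by (auto simp: d'_def)
          show "d' + g + 1 \<le> Suc a" if g: "g \<in> grid" "g < Suc a" for g
          proof (cases dirty)
            case True
            then have "g < a" using g notgrid by (metis less_SucE)
            then show ?thesis using True Suc.prems(8)[OF g(1)] by (simp add: d'_def)
          next
            case False
            then show ?thesis using clean g by (simp add: d'_def)
          qed
          show "d' = 0" if *: "10 * card {x \<in> X. marg f (chosen ?h1) x < \<theta>} \<le> card X"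
          proof -
            \<comment> \<open>Bad candidates stay bad: marginal values decrease, and an accepted
              element has marginal value 0, which is below \<theta>. So a batch once dirty remains
              dirty.\<close>
            have "bad \<subseteq> {x \<in> X. marg f (chosen ?h1) x < \<theta>}"
            proof
              fix y assume y: "y \<in> bad"
              have "marg f (insert x S) y < \<theta>"
              proof (cases "y \<in> insert x S")
                case True
                then show ?thesis using pos_\<theta> by (simp add: marg_def insert_absorb)
              next
                case False
                then have "marg f (insert x S) y \<le> marg f S y"
                  using y x PX XN valid_chosen_subset[OF valid]
                  by (intro marg_antimono) (auto simp: bad_def S_def)
                then show ?thesis using y by (simp add: bad_def)
              qed
              then show "y \<in> {x \<in> X. marg f (chosen ?h1) x < \<theta>}"
                using y by (simp add: bad_def S_def)
            qed
            then have "card bad \<le> card {x \<in> X. marg f (chosen ?h1) x < \<theta>}"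
              using \<open>finite X\<close> by (intro card_mono) auto
            then have "\<not> dirty" using * by (simp add: dirty_def)
            then show ?thesis using clean by (simp add: d'_def)
          qed
        qed
        then show ?thesis using False by (simp add: E_def S_def m_def)
      qed
      moreover have "potential T ?h0 + 27 / 10 * \<theta> * (real d - real a / 16) \<le> E x False"
      proof -
        have "potential T ?h0 + 27 / 10 * \<theta> * (real d - real a / 16)
          \<le> measure_pmf.expectation (draws l (P - {x})) (\<lambda>xs. potential T (walk f k X \<theta> a ?h0 xs))"
          using PX Suc.prems(7-9) by (intro Suc.IH[OF v0 TN XN _ pos_\<theta> size']) auto
        then show ?thesis using False by (simp add: E_def S_def m_def)
      qed
      moreover have "2 * potential T h + 27 / 10 * (25 / 144 * \<theta> - (if m < \<theta> then \<theta> else 0))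
          \<le> potential T ?h1 + potential T ?h0"
        using PX XN x by (intro potential_step valid TN) (auto simp: m_def S_def)
      moreover have "real d' = real d + (if dirty then 1 else 0)" "(if m < \<theta> then \<theta> else 0) = \<theta> * b x"
        by (auto simp: d'_def b_def m_def)
      ultimately have "potential T ?h1 + 27 / 10 * (\<theta> * real d) + 27 / 10 * (\<theta> * (if dirty then 1 else 0))
          - 27 / 160 * (\<theta> * real a) - 27 / 160 * \<theta> \<le> E x True"
        "potential T ?h0 + 27 / 10 * (\<theta> * real d) - 27 / 160 * (\<theta> * real a) \<le> E x False"
        "2 * potential T h + 15 / 32 * \<theta> - 27 / 10 * (\<theta> * b x) \<le> potential T ?h1 + potential T ?h0"
        by (simp_all only: of_nat_Suc) (simp_all add: field_simps)
      moreover have "base = potential T h + 27 / 10 * (\<theta> * real d) - 27 / 160 * (\<theta> * real a)"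
        "27 / 20 * \<theta> * (1 / 9 + (if dirty then 1 else 0) - b x) =
          3 / 20 * \<theta> + 27 / 20 * (\<theta> * (if dirty then 1 else 0)) - 27 / 20 * (\<theta> * b x)"
        by (simp_all only: base_def) (simp_all add: field_simps)
      ultimately show ?thesis by argo
    qed
    have "(\<Sum>x\<in>P. b x) = card {x \<in> P. marg f S x < \<theta>}"
      unfolding b_def using finP by (simp add: sum.If_cases Int_def)
    also have "\<dots> \<le> card P * (1 / 9 + (if dirty then 1 else 0))"
    proof (cases dirty)
      case True
      have "card {x \<in> P. marg f S x < \<theta>} \<le> card P" using finP by (intro card_mono) auto
      then show ?thesis using True by (simp add: algebra_simps)
    next
      case False
      have "card {x \<in> P. marg f S x < \<theta>} \<le> card bad"
        using PX \<open>finite X\<close> by (intro card_mono) (auto simp: bad_def)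
      \<comment> \<open>In a clean state at most \<open>card X / 10\<close> candidates are bad, and
        \<open>9 * card X < 10 * card P\<close>; hence they make up at most a ninth of the
        pool.\<close>
      then have "9 * card {x \<in> P. marg f S x < \<theta>} \<le> card P"
        using False size by (simp add: dirty_def)
      then show ?thesis using False by simp
    qed
    finally have avg: "0 \<le> card P * (1 / 9 + (if dirty then 1 else 0)) - (\<Sum>x\<in>P. b x)" by simp
    have "base * card P \<le> base * card P +
        27 / 20 * \<theta> * (card P * (1 / 9 + (if dirty then 1 else 0)) - (\<Sum>x\<in>P. b x))"
      using pos_\<theta> avg by simp
    also have "\<dots> = (\<Sum>x\<in>P. base + 27 / 20 * \<theta> * (1 / 9 + (if dirty then 1 else 0) - b x))"
    proof -
      have "base * card P + v * (card P * g - (\<Sum>x\<in>P. b x)) = (\<Sum>x\<in>P. base + v * (g - b x))" for v g :: real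
        by (simp add: sum.distrib sum_subtractf flip: sum_distrib_left)
      then show ?thesis .
    qed
    also have "\<dots> \<le> (\<Sum>x\<in>P. (E x True + E x False) / 2)"
      by (rule sum_mono) (rule step)
    finally have "base \<le> (\<Sum>x\<in>P. (E x True + E x False) / 2) / card P"
      using lP by (subst pos_le_divide_eq) auto
    then show ?thesis
      unfolding base_def E_def expectation_draws_Suc[OF finP lP] .
  qed
qed

end

section \<open>Invariants of the rounds\<close>

lemma seen_walk_subset: "seen h \<subseteq> seen (walk f k X \<theta> a h xs)"
proof (induction xs arbitrary: a h)
  case (Cons p xs)
  obtain x c where "p = (x, c)" by (cases p)
  then show ?case
    using Cons[of "(x, c, marg f (chosen h) x, \<theta>) # h" "if c then Suc a else a"] by auto
qed simp

lemma chosen_walk_subset: "chosen h \<subseteq> chosen (walk f k X \<theta> a h xs)"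
proof (induction xs arbitrary: a h)
  case (Cons p xs)
  obtain x c where "p = (x, c)" by (cases p)
  then show ?case
    using Cons[of "(x, c, marg f (chosen h) x, \<theta>) # h" "if c then Suc a else a"] by auto
qed simp

lemma thresholds_walk: "thresholds (walk f k X \<theta> a h xs) \<subseteq> insert \<theta> (thresholds h)"
proof (induction xs arbitrary: a h)
  case (Cons p xs)
  obtain x c where "p = (x, c)" by (cases p)
  then show ?case
    using Cons[of "if c then Suc a else a" "(x, c, marg f (chosen h) x, \<theta>) # h"] by auto
qed auto

lemma valid_walk:
  assumes "valid_history N f h" "distinct (map fst xs)" "fst ` set xs \<subseteq> N - seen h"
  shows "valid_history N f (walk f k X \<theta> a h xs)"
  using assms
proof (induction xs arbitrary: a h)
  case (Cons p xs)
  obtain x c where p: "p = (x, c)" by (cases p)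
  have "valid_history N f (walk f k X \<theta> a' ((x, c, marg f (chosen h) x, \<theta>) # h) xs)" for a'
    using Cons.prems p by (intro Cons.IH) auto
  then show ?case using Cons.prems p by simp
qed simp

lemma card_chosen_walk:
  assumes "card (chosen h) \<le> k"
  shows "card (chosen (walk f k X \<theta> a h xs)) \<le> k"
  using assms
proof (induction xs arbitrary: a h)
  case (Cons p xs)
  obtain x c where p: "p = (x, c)" by (cases p)
  show ?case
  proof (cases "stop f k X \<theta> a (chosen h)")
    case False
    then have "card (chosen h) < k" by (simp add: stop_def)
    then have "card (chosen ((x, c, marg f (chosen h) x, \<theta>) # h)) \<le> k"
      using card_insert_le_m1[of k "chosen h" x] by (cases c) (auto simp: card_insert_if)
    then show ?thesis using False p by (simp add: Cons.IH del: chosen.simps)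
  qed (use Cons.prems p in simp)
qed simp

lemma walk_full:
  assumes "k \<le> card (chosen h)"
  shows "walk f k X \<theta> a h xs = h"
  using assms by (cases xs; cases "hd xs") (auto simp: stop_def)

text \<open>If fewer than \<open>k\<close> elements are chosen at the end, either a test found many
  bad candidates or the batch was drawn completely. \<open>candidates_shrink\<close> exploits
  both.\<close>

lemma walk_exits:
  assumes "h' = walk f k X \<theta> a h xs"
  shows "k \<le> card (chosen h') \<or> card X < 10 * card {x \<in> X. marg f (chosen h') x < \<theta>} \<or>
    fst ` set xs \<subseteq> seen h'"
  using assms
proof (induction xs arbitrary: a h)
  case (Cons p xs)
  obtain x c where p: "p = (x, c)" by (cases p)
  show ?case
  proof (cases "stop f k X \<theta> a (chosen h)")
    case True
    then show ?thesis using Cons.prems p by (auto simp: stop_def)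
  next
    case False
    let ?h = "(x, c, marg f (chosen h) x, \<theta>) # h"
    have h': "h' = walk f k X \<theta> (if c then Suc a else a) ?h xs" using Cons.prems p False by simp
    have "x \<in> seen h'" using seen_walk_subset[of ?h] h' by auto
    then show ?thesis using Cons.IH[OF h'] p by auto
  qed
qed simp

lemma candidates_subset: "candidates f N \<theta> h \<subseteq> N - seen h"
  by (auto simp: candidates_def)

context submodular_instance
begin

lemma finite_candidates: "finite (candidates f N \<theta> h)"
  by (rule finite_subset[OF candidates_subset]) (simp add: finite_ground)

lemma draws_candidates:
  assumes "xs \<in> set_pmf (draws (batch_size (candidates f N \<theta> h)) (candidates f N \<theta> h))"
  shows "length xs = batch_size (candidates f N \<theta> h)" "distinct (map fst xs)"
    "fst ` set xs \<subseteq> candidates f N \<theta> h"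
  by (rule set_pmf_draws[OF finite_candidates batch_size_le assms])+

lemma valid_round:
  assumes "valid_history N f h"
    and "xs \<in> set_pmf (draws (batch_size (candidates f N \<theta> h)) (candidates f N \<theta> h))"
  shows "valid_history N f (walk f k (candidates f N \<theta> h) \<theta> 0 h xs)"
  using assms draws_candidates[OF assms(2)] candidates_subset[of f N \<theta> h]
  by (intro valid_walk) auto

lemma valid_rounds:
  "valid_history N f h \<Longrightarrow> h' \<in> set_pmf (rounds f N k \<theta>s h) \<Longrightarrow> valid_history N f h'"
proof (induction \<theta>s arbitrary: h)
  case (Cons \<theta> \<theta>s)
  then obtain xs where
    "xs \<in> set_pmf (draws (batch_size (candidates f N \<theta> h)) (candidates f N \<theta> h))"
    "h' \<in> set_pmf (rounds f N k \<theta>s (walk f k (candidates f N \<theta> h) \<theta> 0 h xs))"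
    by auto
  then show ?case using Cons.IH valid_round[OF Cons.prems(1)] by blast
qed simp

lemma card_rounds:
  "card (chosen h) \<le> k \<Longrightarrow> h' \<in> set_pmf (rounds f N k \<theta>s h) \<Longrightarrow> card (chosen h') \<le> k"
proof (induction \<theta>s arbitrary: h)
  case (Cons \<theta> \<theta>s)
  then obtain xs where
    "h' \<in> set_pmf (rounds f N k \<theta>s (walk f k (candidates f N \<theta> h) \<theta> 0 h xs))"
    by auto
  then show ?case using Cons.IH card_chosen_walk[OF Cons.prems(1)] by blast
qed simp

lemma finite_set_pmf_rounds: "finite (set_pmf (rounds f N k \<theta>s h))"
proof (induction \<theta>s arbitrary: h)
  case (Cons \<theta> \<theta>s)
  show ?case unfolding rounds.simps set_bind_pmf
    by (intro finite_UN_I finite_set_pmf_draws finite_candidates batch_size_le Cons)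
qed simp

lemma expectation_rounds_Cons:
  fixes F :: "'a history \<Rightarrow> real"
  shows "measure_pmf.expectation (rounds f N k (\<theta> # \<theta>s) h) F =
    measure_pmf.expectation (draws (batch_size (candidates f N \<theta> h)) (candidates f N \<theta> h))
      (\<lambda>xs. measure_pmf.expectation (rounds f N k \<theta>s (walk f k (candidates f N \<theta> h) \<theta> 0 h xs)) F)"
proof -
  let ?p = "draws (batch_size (candidates f N \<theta> h)) (candidates f N \<theta> h)"
  have fin: "finite (set_pmf ?p)"
    by (intro finite_set_pmf_draws finite_candidates batch_size_le)
  show ?thesis unfolding rounds.simps
    by (subst pmf_expectation_bind[OF fin finite_set_pmf_rounds subset_refl])
       (rule integral_measure_pmf[OF fin, symmetric])
qed

lemma expectation_potential_rounds:
  assumes "valid_history N f h" "T \<subseteq> N" "\<And>\<theta>. \<theta> \<in> set \<theta>s \<Longrightarrow> 0 < \<theta>"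
  shows "potential T h \<le> measure_pmf.expectation (rounds f N k \<theta>s h) (potential T)"
  using assms
proof (induction \<theta>s arbitrary: h)
  case (Cons \<theta> \<theta>s)
  define X where "X = candidates f N \<theta> h"
  have fin: "finite (set_pmf (draws (batch_size X) X))"
    unfolding X_def by (intro finite_set_pmf_draws finite_candidates batch_size_le)
  \<comment> \<open>A batch starts with \<open>d = a = 0\<close>. The size condition holds because
    ten times a tenth rounded up is less than \<open>card X + 10\<close>.\<close>
  have "potential T h + 27 / 10 * \<theta> * (real 0 - real 0 / 16) \<le>
      measure_pmf.expectation (draws (batch_size X) X) (\<lambda>xs. potential T (walk f k X \<theta> 0 h xs))"
    using Cons.prems candidates_subset[of f N \<theta> h]
    by (intro expectation_potential_walk) (auto simp: X_def batch_size_def)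
  also have "\<dots> \<le> measure_pmf.expectation (draws (batch_size X) X)
      (\<lambda>xs. measure_pmf.expectation (rounds f N k \<theta>s (walk f k X \<theta> 0 h xs)) (potential T))"
    using Cons.prems
    by (intro integral_mono_AE integrable_measure_pmf_finite[OF fin])
       (auto simp: AE_measure_pmf_iff X_def intro!: Cons.IH valid_round)
  also have "\<dots> = measure_pmf.expectation (rounds f N k (\<theta> # \<theta>s) h) (potential T)"
    unfolding expectation_rounds_Cons X_def ..
  finally show ?case by simp
qed simp

lemma candidates_walk_subset:
  assumes "valid_history N f (walk f k X \<theta> a h xs)"
  shows "candidates f N \<theta>' (walk f k X \<theta> a h xs) \<subseteq> candidates f N \<theta>' h"
proof
  fix x assume x: "x \<in> candidates f N \<theta>' (walk f k X \<theta> a h xs)"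
  have "marg f (chosen (walk f k X \<theta> a h xs)) x \<le> marg f (chosen h) x"
    using x chosen_walk_subset[of h] valid_chosen_subset[OF assms] chosen_subset_seen
    by (intro marg_antimono) (fastforce simp: candidates_def)+
  then show "x \<in> candidates f N \<theta>' h"
    using x seen_walk_subset[of h] by (force simp: candidates_def)
qed

text \<open>Either more than a tenth of the candidates fell below \<theta>, or the whole batch, at
  least a tenth of them, has been seen.\<close>

lemma candidates_shrink:
  assumes "valid_history N f h"
    and xs: "xs \<in> set_pmf (draws (batch_size (candidates f N \<theta> h)) (candidates f N \<theta> h))"
    and h': "h' = walk f k (candidates f N \<theta> h) \<theta> 0 h xs"
  shows "k \<le> card (chosen h') \<or> 10 * card (candidates f N \<theta> h') \<le> 9 * card (candidates f N \<theta> h)"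
proof -
  define X where "X = candidates f N \<theta> h"
  define B where "B = {x \<in> X. marg f (chosen h') x < \<theta>}"
  have finX: "finite X" unfolding X_def by (rule finite_candidates)
  have sub: "candidates f N \<theta> h' \<subseteq> X"
    unfolding X_def h' using assms by (intro candidates_walk_subset valid_round)
  consider "k \<le> card (chosen h')" | "card X < 10 * card B" | "fst ` set xs \<subseteq> seen h'"
    using walk_exits[OF h'] unfolding X_def B_def by blast
  then show ?thesis
  proof cases
    case 2
    have "candidates f N \<theta> h' \<subseteq> X - B" using sub by (auto simp: candidates_def B_def)
    then have "card (candidates f N \<theta> h') \<le> card (X - B)" using finX by (intro card_mono) auto
    also have "\<dots> = card X - card B" using finX by (intro card_Diff_subset) (auto simp: B_def)
    finally have "card (candidates f N \<theta> h') \<le> card X - card B" .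
    moreover have "10 * c \<le> 9 * n" if "c \<le> n - b" "n < 10 * b" for b c n :: nat
      using that by arith
    ultimately show ?thesis using 2 unfolding X_def by blast
  next
    case 3
    have "candidates f N \<theta> h' \<subseteq> X - fst ` set xs" using sub 3 by (auto simp: candidates_def)
    then have "card (candidates f N \<theta> h') \<le> card (X - fst ` set xs)"
      using finX by (intro card_mono) auto
    also have "\<dots> = card X - card (fst ` set xs)"
      using draws_candidates[OF xs] by (intro card_Diff_subset) (auto simp: X_def)
    also have "card (fst ` set xs) = batch_size X"
      using draws_candidates[OF xs] distinct_card[of "map fst xs"] by (simp add: X_def)
    finally have "card (candidates f N \<theta> h') \<le> card X - (card X + 9) div 10"
      by (simp add: batch_size_def)
    moreover have "10 * c \<le> 9 * n" if "c \<le> n - (n + 9) div 10" for c n :: nat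
      using that by arith
    ultimately show ?thesis unfolding X_def by blast
  qed blast
qed

end

section \<open>Threshold levels and the final charging argument\<close>

text \<open>Each level is repeated \<open>R\<close> times to exhaust its candidates. Eighty levels
  bring the threshold down to \<open>t * (9 / 10) ^ 79\<close>, below
  \<open>t / 1000\<close>.\<close>

definition schedule :: "nat \<Rightarrow> real \<Rightarrow> real list" where
  "schedule R t = concat (map (\<lambda>j. replicate R (t * (9 / 10) ^ j)) [0..<80])"

lemma recorded_coin:
  "valid_history N f h \<Longrightarrow> (x, c, m, \<theta>) \<in> set h \<Longrightarrow> c \<longleftrightarrow> x \<in> chosen h"
proof (induction h)
  case (Cons e h)
  obtain y d m' \<theta>' where e: "e = (y, d, m', \<theta>')" by (cases e)
  have y: "y \<notin> seen h" and valid: "valid_history N f h" using Cons.prems e by auto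
  show ?case
  proof (cases "(x, c, m, \<theta>) \<in> set h")
    case True
    then have "x \<in> seen h" by (force simp: seen_def)
    then have "x \<noteq> y" using y by auto
    then show ?thesis using Cons.IH[OF valid True] e by auto
  next
    case False
    then have "x = y" "c = d" using Cons.prems e by auto
    moreover have "y \<notin> chosen h" using y chosen_subset_seen[of h] by auto
    ultimately show ?thesis using e by auto
  qed
qed simp

context submodular_instance
begin

lemma rounds_full:
  assumes "k \<le> card (chosen h)" "h' \<in> set_pmf (rounds f N k \<theta>s h)"
  shows "h' = h"
  using assms by (induction \<theta>s) (auto simp: walk_full)

lemma set_pmf_rounds_append:
  "set_pmf (rounds f N k (\<theta>s @ \<theta>s') h) =
     (\<Union>h1\<in>set_pmf (rounds f N k \<theta>s h). set_pmf (rounds f N k \<theta>s' h1))"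
  by (induction \<theta>s arbitrary: h) auto

lemma rounds_ConsE:
  assumes "h' \<in> set_pmf (rounds f N k (\<theta> # \<theta>s) h)"
  obtains xs where
    "xs \<in> set_pmf (draws (batch_size (candidates f N \<theta> h)) (candidates f N \<theta> h))"
    "h' \<in> set_pmf (rounds f N k \<theta>s (walk f k (candidates f N \<theta> h) \<theta> 0 h xs))"
  using assms by auto

lemma candidates_rounds_subset:
  assumes "valid_history N f h" "h' \<in> set_pmf (rounds f N k \<theta>s h)"
  shows "candidates f N \<theta>' h' \<subseteq> candidates f N \<theta>' h"
  using assms
proof (induction \<theta>s arbitrary: h)
  case (Cons \<theta> \<theta>s)
  from Cons.prems(2) obtain xs where
    xs: "xs \<in> set_pmf (draws (batch_size (candidates f N \<theta> h)) (candidates f N \<theta> h))" and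
    h': "h' \<in> set_pmf (rounds f N k \<theta>s (walk f k (candidates f N \<theta> h) \<theta> 0 h xs))"
    by (rule rounds_ConsE)
  have valid: "valid_history N f (walk f k (candidates f N \<theta> h) \<theta> 0 h xs)"
    by (rule valid_round[OF Cons.prems(1) xs])
  show ?case
    using Cons.IH[OF valid h'] candidates_walk_subset[OF valid] by (rule subset_trans)
qed simp

lemma thresholds_rounds:
  assumes "h' \<in> set_pmf (rounds f N k \<theta>s h)"
  shows "thresholds h' \<subseteq> thresholds h \<union> set \<theta>s"
  using assms
proof (induction \<theta>s arbitrary: h)
  case (Cons \<theta> \<theta>s)
  from Cons.prems obtain xs where
    h': "h' \<in> set_pmf (rounds f N k \<theta>s (walk f k (candidates f N \<theta> h) \<theta> 0 h xs))"
    by (rule rounds_ConsE)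
  show ?case using Cons.IH[OF h'] thresholds_walk by fastforce
qed simp

text \<open>This iterates \<open>candidates_shrink\<close>. Once \<open>k\<close> elements are
  chosen the history is frozen, so the first alternative persists.\<close>

lemma candidates_rounds_replicate:
  assumes "valid_history N f h" "h' \<in> set_pmf (rounds f N k (replicate R \<theta>) h)"
  shows "k \<le> card (chosen h') \<or>
    10 ^ R * card (candidates f N \<theta> h') \<le> 9 ^ R * card (candidates f N \<theta> h)"
  using assms
proof (induction R arbitrary: h)
  case (Suc R)
  have "h' \<in> set_pmf (rounds f N k (\<theta> # replicate R \<theta>) h)" using Suc.prems(2) by simp
  then obtain xs where
    xs: "xs \<in> set_pmf (draws (batch_size (candidates f N \<theta> h)) (candidates f N \<theta> h))" and
    h': "h' \<in> set_pmf (rounds f N k (replicate R \<theta>) (walk f k (candidates f N \<theta> h) \<theta> 0 h xs))"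
    by (rule rounds_ConsE)
  define h1 where "h1 = walk f k (candidates f N \<theta> h) \<theta> 0 h xs"
  have valid: "valid_history N f h1"
    unfolding h1_def by (rule valid_round[OF Suc.prems(1) xs])
  have "k \<le> card (chosen h') \<or>
      10 ^ R * card (candidates f N \<theta> h') \<le> 9 ^ R * card (candidates f N \<theta> h1)"
    using Suc.IH[OF valid] h' unfolding h1_def by blast
  moreover have "k \<le> card (chosen h1) \<or>
      10 * card (candidates f N \<theta> h1) \<le> 9 * card (candidates f N \<theta> h)"
    by (rule candidates_shrink[OF Suc.prems(1) xs h1_def])
  moreover have "h' = h1" if "k \<le> card (chosen h1)"
    using rounds_full[OF that] h' unfolding h1_def by blast
  moreover have "10 ^ Suc R * a \<le> 9 ^ Suc R * c"
    if "10 ^ R * a \<le> 9 ^ R * b" "10 * b \<le> 9 * c" for a b c :: nat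
  proof -
    have "10 ^ Suc R * a = 10 * (10 ^ R * a)" by simp
    also have "\<dots> \<le> 10 * (9 ^ R * b)" using that(1) by (rule mult_le_mono2)
    also have "\<dots> = 9 ^ R * (10 * b)" by (simp only: mult.left_commute)
    also have "\<dots> \<le> 9 ^ R * (9 * c)" using that(2) by (rule mult_le_mono2)
    also have "\<dots> = 9 ^ Suc R * c" by (simp only: power_Suc mult_ac)
    finally show ?thesis .
  qed
  ultimately show ?case by blast
qed simp

text \<open>Seven rounds halve the number of candidates, as \<open>2 * 9 ^ 7 \<le> 10 ^ 7\<close>.
  After \<open>7 * s\<close> rounds fewer than one is left.\<close>

lemma level_exhausts:
  assumes "valid_history N f h" "h' \<in> set_pmf (rounds f N k (replicate (7 * s) \<theta>) h)"
    and "card N < 2 ^ s"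
  shows "k \<le> card (chosen h') \<or> candidates f N \<theta> h' = {}"
proof -
  have "card (candidates f N \<theta> h) \<le> card N"
    using candidates_subset[of f N \<theta> h] finite_ground by (intro card_mono) auto
  then have "9 ^ (7 * s) * card (candidates f N \<theta> h) < 9 ^ (7 * s) * 2 ^ s"
    using assms(3) by simp
  also have "9 ^ (7 * s) * 2 ^ s = (9 ^ 7 * 2 :: nat) ^ s"
    by (simp only: power_mult power_mult_distrib)
  also have "\<dots> \<le> (10 ^ 7) ^ s" by (rule power_mono) simp_all
  also have "\<dots> = 10 ^ (7 * s)" by (simp only: power_mult)
  finally have less: "9 ^ (7 * s) * card (candidates f N \<theta> h) < 10 ^ (7 * s)" .
  show ?thesis
  proof (rule disjCI)
    assume "candidates f N \<theta> h' \<noteq> {}"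
    then have "1 \<le> card (candidates f N \<theta> h')"
      using finite_candidates by (simp add: Suc_le_eq card_gt_0_iff)
    then have "10 ^ (7 * s) * 1 \<le> 10 ^ (7 * s) * card (candidates f N \<theta> h')"
      by (rule mult_le_mono2)
    then have "\<not> 10 ^ (7 * s) * card (candidates f N \<theta> h') \<le> 9 ^ (7 * s) * card (candidates f N \<theta> h)"
      using less by linarith
    then show "k \<le> card (chosen h')"
      using candidates_rounds_replicate[OF assms(1,2)] by blast
  qed
qed

text \<open>Here \<open>t\<close> is the first threshold and \<open>u\<close> the current one. A
  full history was filled either at the first level or at the level right after an exhausted one,
  \<open>v\<close>; the factor 9/10 is the ratio of consecutive levels.\<close>

definition settled :: "nat \<Rightarrow> real \<Rightarrow> real \<Rightarrow> 'a history \<Rightarrow> bool" where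
  "settled k t u h \<longleftrightarrow>
     card (chosen h) < k \<and> candidates f N u h = {} \<and> (\<forall>\<theta>\<in>thresholds h. u \<le> \<theta>) \<or>
     k \<le> card (chosen h) \<and> ((\<forall>\<theta>\<in>thresholds h. t \<le> \<theta>) \<or>
       (\<exists>v. candidates f N v h = {} \<and> (\<forall>\<theta>\<in>thresholds h. 9 / 10 * v \<le> \<theta>)))"

lemma settled_first:
  assumes "h' \<in> set_pmf (rounds f N k (replicate (7 * s) t) [])" "card N < 2 ^ s"
  shows "settled k t t h'"
proof -
  have "thresholds h' \<subseteq> {t}" using thresholds_rounds[OF assms(1)] by auto
  moreover have "k \<le> card (chosen h') \<or> candidates f N t h' = {}"
    using assms by (intro level_exhausts[of "[]"]) auto
  ultimately show ?thesis unfolding settled_def by force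
qed

text \<open>A full history no longer changes. Otherwise \<open>u\<close> stays exhausted, and it
  serves as the witness \<open>v\<close> if the new level fills the history.\<close>

lemma settled_next:
  assumes "settled k t u h" "valid_history N f h" "0 < u" "card N < 2 ^ s"
    and h': "h' \<in> set_pmf (rounds f N k (replicate (7 * s) (9 / 10 * u)) h)"
  shows "settled k t (9 / 10 * u) h'"
proof (cases "k \<le> card (chosen h)")
  case True
  have "h' = h" by (rule rounds_full[OF True h'])
  then show ?thesis using True assms(1) by (auto simp: settled_def)
next
  case False
  then have old: "candidates f N u h = {}" "\<forall>\<theta>\<in>thresholds h. u \<le> \<theta>"
    using assms(1) by (auto simp: settled_def)
  have "thresholds h' \<subseteq> insert (9 / 10 * u) (thresholds h)"
    using thresholds_rounds[OF h'] by auto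
  then have "\<forall>\<theta>\<in>thresholds h'. 9 / 10 * u \<le> \<theta>" using old(2) assms(3) by force
  moreover have "candidates f N u h' = {}"
    using candidates_rounds_subset[OF assms(2) h'] old(1) by blast
  moreover have "k \<le> card (chosen h') \<or> candidates f N (9 / 10 * u) h' = {}"
    using assms by (intro level_exhausts[of h]) auto
  ultimately show ?thesis unfolding settled_def by (metis not_le)
qed

lemma settled_schedule:
  assumes "h' \<in> set_pmf (rounds f N k (schedule (7 * s) t) [])" "card N < 2 ^ s" "0 < t"
  shows "settled k t (t * (9 / 10) ^ 79) h'"
proof -
  have "settled k t (t * (9 / 10) ^ L) h'"
    if "h' \<in> set_pmf (rounds f N k (concat (map (\<lambda>j. replicate (7 * s) (t * (9 / 10) ^ j)) [0..<Suc L])) [])"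
    for L h'
    using that
  proof (induction L arbitrary: h')
    case 0
    then show ?case using settled_first[OF _ assms(2)] by simp
  next
    case (Suc L)
    let ?l = "\<lambda>L. concat (map (\<lambda>j. replicate (7 * s) (t * (9 / 10) ^ j)) [0..<L])"
    have "?l (Suc (Suc L)) = ?l (Suc L) @ replicate (7 * s) (9 / 10 * (t * (9 / 10) ^ L))"
      by (simp add: mult_ac)
    then have "h' \<in> set_pmf (rounds f N k (?l (Suc L) @ replicate (7 * s) (9 / 10 * (t * (9 / 10) ^ L))) [])"
      using Suc.prems by (simp only:)
    then obtain h where h: "h \<in> set_pmf (rounds f N k (?l (Suc L)) [])"
      and h': "h' \<in> set_pmf (rounds f N k (replicate (7 * s) (9 / 10 * (t * (9 / 10) ^ L))) h)"
      unfolding set_pmf_rounds_append by blast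
    have valid: "valid_history N f h" using valid_rounds[OF _ h] by simp
    have "settled k t (9 / 10 * (t * (9 / 10) ^ L)) h'"
      using assms(3) by (intro settled_next[OF Suc.IH[OF h] valid _ assms(2) h']) simp
    moreover have "9 / 10 * (t * (9 / 10) ^ L) = t * (9 / 10) ^ Suc L" by simp
    ultimately show ?case by (simp only:)
  qed
  from this[of h' 79] assms(1) show ?thesis by (simp add: schedule_def)
qed

text \<open>
  Elements of \<open>T\<close> rejected by their coin are paid for by the accepted elements of \<open>T\<close>, because
  the coins are fair. If \<open>k\<close> elements were chosen, the elements of \<open>T\<close> that were never considered
  are paid for by the chosen elements outside \<open>T\<close>, or by the total value if even the first
  threshold was met \<open>k\<close> times.
\<close>

lemma value_union_le:
  assumes valid: "valid_history N f h" and card_k: "card (chosen h) \<le> k"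
    and settled: "settled k t u h" and pos: "\<And>\<theta>. \<theta> \<in> thresholds h \<Longrightarrow> 0 < \<theta>"
    and TN: "T \<subseteq> N" and cardT: "card T \<le> k"
    and opt: "\<And>A. A \<subseteq> T \<Longrightarrow> f A \<le> V"
    and t: "10 * V \<le> k * t" and u: "k * u \<le> V / 50" "0 \<le> u"
  shows "f (chosen h \<union> T) \<le> f (chosen h)
    + hsum (\<lambda>x c m \<theta>. if \<not> c \<and> x \<in> T then max m \<theta> else 0) h + V / 50
    + 10 / 9 * hsum (\<lambda>x c m \<theta>. if c \<and> x \<notin> T then max m \<theta> else 0) h
    + 1 / 10 * hsum (\<lambda>x c m \<theta>. if c then max m \<theta> else 0) h"
    (is "_ \<le> _ + ?RO + _ + 10 / 9 * ?WN + 1 / 10 * ?W")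
proof -
  define S where "S = chosen h"
  \<comment> \<open>\<open>T\<close> splits into its chosen elements, the rejected ones
    \<open>Rj\<close> and the unseen ones \<open>T3\<close>.\<close>
  define Rj where "Rj = T \<inter> seen h - S"
  define T3 where "T3 = T - seen h"
  have finT: "finite T" using TN finite_ground by (rule finite_subset)
  have SN: "S \<subseteq> N" unfolding S_def by (rule valid_chosen_subset[OF valid])
  have finS: "finite S" by (simp add: S_def)
  have Sseen: "S \<subseteq> seen h" unfolding S_def by (rule chosen_subset_seen)
  have pos': "0 < \<theta>" if "(x, c, m, \<theta>) \<in> set h" for x c m \<theta>
    using that by (intro pos) (force simp: thresholds_def)
  have V: "0 \<le> V" using opt[of "{}"] nonneg[of "{}"] by simp
  have WN: "0 \<le> ?WN"
    using sum_le_hsum[OF valid, of "{}" "\<lambda>x c m \<theta>. if c \<and> x \<notin> T then max m \<theta> else 0"] pos'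
    by (force simp: le_max_iff_disj less_imp_le)
  have W: "0 \<le> ?W"
    using sum_le_hsum[OF valid, of "{}" "\<lambda>x c m \<theta>. if c then max m \<theta> else 0"] pos'
    by (force simp: le_max_iff_disj less_imp_le)
  have RO: "(\<Sum>x\<in>Rj. marg f S x) \<le> ?RO"
  proof (rule sum_le_hsum[OF valid])
    show "Rj \<subseteq> seen h" by (auto simp: Rj_def)
    fix x c m \<theta> assume e: "(x, c, m, \<theta>) \<in> set h"
    show "0 \<le> (if \<not> c \<and> x \<in> T then max m \<theta> else 0)"
      using pos'[OF e] by (simp add: le_max_iff_disj)
    assume x: "x \<in> Rj"
    have "\<not> c" using recorded_coin[OF valid e] x by (simp add: Rj_def S_def)
    moreover have "marg f S x \<le> m"
      unfolding S_def using x by (intro marg_recorded[OF valid e]) (simp add: Rj_def S_def)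
    ultimately show "marg f S x \<le> (if \<not> c \<and> x \<in> T then max m \<theta> else 0)"
      using x by (simp add: Rj_def)
  qed
  have "f (S \<union> Rj) \<le> f S + (\<Sum>x\<in>Rj. marg f S x)"
    using TN by (intro union_le_sum_marg[OF SN]) (auto simp: Rj_def)
  then have rej: "f (S \<union> Rj) \<le> f S + ?RO" using RO by argo
  have unseen: "f (S \<union> T) \<le> f S + ?RO + card T3 * v" if v: "candidates f N v h = {}" for v :: real
  proof -
    have "S \<union> T = S \<union> (Rj \<union> T3)" by (auto simp: Rj_def T3_def S_def)
    moreover have "f (S \<union> (Rj \<union> T3)) \<le> f S + (\<Sum>x\<in>Rj \<union> T3. marg f S x)"
      using TN Sseen by (intro union_le_sum_marg[OF SN]) (auto simp: Rj_def T3_def)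
    ultimately have "f (S \<union> T) \<le> f S + (\<Sum>x\<in>Rj \<union> T3. marg f S x)" by (simp only:)
    also have "(\<Sum>x\<in>Rj \<union> T3. marg f S x) = (\<Sum>x\<in>Rj. marg f S x) + (\<Sum>x\<in>T3. marg f S x)"
      using finT by (intro sum.union_disjoint) (auto simp: Rj_def T3_def)
    also have "(\<Sum>x\<in>T3. marg f S x) \<le> card T3 * v"
    proof (rule sum_bounded_above)
      fix x assume "x \<in> T3"
      then show "marg f S x \<le> v" using v TN by (force simp: T3_def candidates_def S_def)
    qed
    finally show ?thesis using RO by simp
  qed
  consider (few) "candidates f N u h = {}"
    | (top) "card S = k" "\<forall>\<theta>\<in>thresholds h. t \<le> \<theta>"
    | (full) v where "card S = k" "candidates f N v h = {}" "\<forall>\<theta>\<in>thresholds h. 9 / 10 * v \<le> \<theta>"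
    using settled card_k unfolding settled_def S_def by force
  then have "f (S \<union> T) \<le> f S + ?RO + V / 50 + 10 / 9 * ?WN + 1 / 10 * ?W"
  proof cases
    case few
    have "card T3 \<le> k" using cardT card_mono[OF finT, of T3] by (simp add: T3_def)
    then have "card T3 * u \<le> k * u" using u(2) by (intro mult_right_mono) auto
    then show ?thesis using unseen[OF few] u(1) WN W by argo
  next
    case top
    have "card S * t = (\<Sum>x\<in>S. t)" by simp
    also have "\<dots> \<le> ?W"
    proof (rule sum_le_hsum[OF valid Sseen])
      fix x c m \<theta> assume e: "(x, c, m, \<theta>) \<in> set h"
      show "0 \<le> (if c then max m \<theta> else 0)"
        using pos'[OF e] by (simp add: le_max_iff_disj)
      assume x: "x \<in> S"
      have "c" using recorded_coin[OF valid e] x by (simp add: S_def)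
      moreover have "\<theta> \<in> thresholds h" using e by (force simp: thresholds_def)
      ultimately show "t \<le> (if c then max m \<theta> else 0)"
        using top(2) by (simp add: le_max_iff_disj)
    qed
    finally have W_ge: "10 * V \<le> ?W" using t top(1) by simp
    \<comment> \<open>By subadditivity the unseen elements add at most \<open>f T3 \<le> V\<close>,
      a tenth of the accepted weight.\<close>
    have "S \<union> T = (S \<union> Rj) \<union> T3" by (auto simp: Rj_def T3_def S_def)
    moreover have "f ((S \<union> Rj) \<union> T3) \<le> f (S \<union> Rj) + f T3"
      using SN TN by (intro subadditive) (auto simp: Rj_def T3_def)
    ultimately have "f (S \<union> T) \<le> f (S \<union> Rj) + f T3" by (simp only:)
    moreover have "f T3 \<le> V" by (rule opt) (auto simp: T3_def)
    ultimately show ?thesis using rej W_ge WN V by argo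
  next
    case (full v)
    have "card (S - T) * (9 / 10 * v) = (\<Sum>x\<in>S - T. 9 / 10 * v)" by simp
    also have "\<dots> \<le> ?WN"
    proof (rule sum_le_hsum[OF valid])
      show "S - T \<subseteq> seen h" using Sseen by auto
      fix x c m \<theta> assume e: "(x, c, m, \<theta>) \<in> set h"
      show "0 \<le> (if c \<and> x \<notin> T then max m \<theta> else 0)"
        using pos'[OF e] by (simp add: le_max_iff_disj)
      assume x: "x \<in> S - T"
      have "c" using recorded_coin[OF valid e] x by (simp add: S_def)
      moreover have "\<theta> \<in> thresholds h" using e by (force simp: thresholds_def)
      ultimately show "9 / 10 * v \<le> (if c \<and> x \<notin> T then max m \<theta> else 0)"
        using full(3) x by (simp add: le_max_iff_disj)
    qed
    finally have 1: "card (S - T) * v \<le> 10 / 9 * ?WN" by (simp add: field_simps)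
    \<comment> \<open>Since \<open>card T \<le> k = card S\<close>, the unseen elements of
      \<open>T\<close> can be matched injectively with the chosen elements outside
      \<open>T\<close>.\<close>
    have "card T3 \<le> card (T - S)"
      using finT Sseen by (intro card_mono) (auto simp: T3_def)
    also have "card (T - S) = card T - card (S \<inter> T)"
      using finT by (simp add: card_Diff_subset_Int Int_commute)
    also have "\<dots> \<le> card S - card (S \<inter> T)" using cardT full(1) by simp
    also have "\<dots> = card (S - T)"
      using finS by (simp add: card_Diff_subset_Int)
    finally have 2: "card T3 \<le> card (S - T)" .
    \<comment> \<open>\<open>settled\<close> does not fix the sign of \<open>v\<close>; for negative
      \<open>v\<close> the bound is immediate.\<close>
    have "card T3 * v \<le> 10 / 9 * ?WN"
    proof (cases "0 \<le> v")
      case True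
      have "card T3 * v \<le> card (S - T) * v" using 2 True by (intro mult_right_mono) auto
      then show ?thesis using 1 by argo
    next
      case False
      have "card T3 * v \<le> 0" using False by (intro mult_nonneg_nonpos) auto
      then show ?thesis using WN by argo
    qed
    then show ?thesis using unseen[OF full(2)] V W by argo
  qed
  then show ?thesis by (simp only: S_def)
qed

text \<open>The rejected elements of \<open>T\<close> cancel against their charge. The weight
  \<open>W\<close> then has coefficient at most \<open>1 + 10/9 + 1/10 + 15/32 < 27/10\<close>,
  where \<open>15/32 = 27/10 * 25/144\<close>. As \<open>W = good + bad\<close>, the charge for
  \<open>bad\<close> leaves only \<open>27/10 * good\<close>, which \<open>kept\<close>
  retains.\<close>

lemma potential_le:
  assumes valid: "valid_history N f h" and "card (chosen h) \<le> k"
    and "settled k t u h" and pos: "\<And>\<theta>. \<theta> \<in> thresholds h \<Longrightarrow> 0 < \<theta>"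
    and TN: "T \<subseteq> N" and "card T \<le> k"
    and "\<And>A. A \<subseteq> T \<Longrightarrow> f A \<le> V"
    and "10 * V \<le> k * t" and "k * u \<le> V / 50" "0 \<le> u"
  shows "potential T h \<le> V / 50 + 27 / 10 * f (kept h)"
proof -
  have pos': "0 < \<theta>" if "(x, c, m, \<theta>) \<in> set h" for x c m \<theta>
    using that by (intro pos) (force simp: thresholds_def)
  define RO where "RO = hsum (\<lambda>x c m \<theta>. if \<not> c \<and> x \<in> T then max m \<theta> else 0) h"
  define WO where "WO = hsum (\<lambda>x c m \<theta>. if c \<and> x \<in> T then max m \<theta> else 0) h"
  define WN where "WN = hsum (\<lambda>x c m \<theta>. if c \<and> x \<notin> T then max m \<theta> else 0) h"
  define W where "W = hsum (\<lambda>x c m \<theta>. if c then max m \<theta> else 0) h"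
  define good where "good = hsum (\<lambda>x c m \<theta>. if c \<and> \<theta> \<le> m then m else 0) h"
  define bad where "bad = hsum (\<lambda>x c m \<theta>. if c \<and> m < \<theta> then \<theta> else 0) h"
  define all where "all = hsum (\<lambda>x c m \<theta>. if c then \<theta> else 0) h"
  have union: "f (chosen h \<union> T) \<le> f (chosen h) + RO + V / 50 + 10 / 9 * WN + 1 / 10 * W"
    unfolding RO_def WN_def W_def by (rule value_union_le[OF assms])
  have "W = WO + WN" unfolding W_def WO_def WN_def hsum_add[symmetric]
    by (rule arg_cong[of _ _ "\<lambda>\<phi>. hsum \<phi> h"]) (auto simp: fun_eq_iff)
  moreover have "W = good + bad" unfolding W_def good_def bad_def hsum_add[symmetric]
    by (rule arg_cong[of _ _ "\<lambda>\<phi>. hsum \<phi> h"]) (auto simp: fun_eq_iff)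
  moreover have "all \<le> W" unfolding W_def all_def by (rule hsum_mono) auto
  moreover have "0 \<le> WO"
    using sum_le_hsum[OF valid, of "{}" "\<lambda>x c m \<theta>. if c \<and> x \<in> T then max m \<theta> else 0"] pos'
    unfolding WO_def by (force simp: le_max_iff_disj less_imp_le)
  moreover have "0 \<le> W"
    using sum_le_hsum[OF valid, of "{}" "\<lambda>x c m \<theta>. if c then max m \<theta> else 0"] pos'
    unfolding W_def by (force simp: le_max_iff_disj less_imp_le)
  moreover have "f (chosen h) \<le> f {} + W"
    unfolding value_chosen[OF valid] W_def by (intro add_left_mono hsum_mono) auto
  moreover have "f {} + good \<le> f (kept h)"
    unfolding good_def by (rule value_kept[OF valid])
  moreover have "hsum (charge T) h = WO + - 1 * RO + (27 / 10 * (25 / 144)) * all + - (27 / 10) * bad"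
    unfolding WO_def RO_def all_def bad_def hsum_cmult[symmetric] hsum_add[symmetric]
    by (rule arg_cong[of _ _ "\<lambda>\<phi>. hsum \<phi> h"]) (auto simp: fun_eq_iff charge_def)
  moreover have "potential T h \<le> f (chosen h \<union> T) + hsum (charge T) h"
    unfolding potential_def by (intro add_right_mono cover_le) auto
  moreover have "0 \<le> f {}" by (rule nonneg) simp
  ultimately show ?thesis using union by argo
qed

lemma expectation_kept_ge:
  assumes "T \<subseteq> N" "card T \<le> k" "\<And>A. A \<subseteq> T \<Longrightarrow> f A \<le> f T"
    and t: "10 * f T \<le> k * t" "k * t \<le> 20 * f T" "0 < t" and "card N < 2 ^ s"
  shows "f T \<le> 5.83 * measure_pmf.expectation (rounds f N k (schedule (7 * s) t) []) (\<lambda>h. f (kept h))"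
proof -
  let ?p = "rounds f N k (schedule (7 * s) t) []"
  define u where "u = t * (9 / 10) ^ 79"
  \<comment> \<open>With \<open>k * t \<le> 20 * f T\<close> this gives
    \<open>k * u \<le> f T / 50\<close> for the last threshold.\<close>
  have "(9 / 10) ^ 79 \<le> (1 / 1000 :: real)" by (simp add: power_divide)
  then have "k * t * (9 / 10) ^ 79 \<le> k * t * (1 / 1000)" using t(3) by (intro mult_left_mono) auto
  then have u: "k * u \<le> f T / 50" "0 \<le> u" using t(2,3) by (auto simp: u_def)
  have V: "0 \<le> f T" by (rule nonneg[OF assms(1)])
  have sched: "0 < \<theta>" if "\<theta> \<in> set (schedule (7 * s) t)" for \<theta>
    using that t(3) by (auto simp: schedule_def)
  have "f T / 2 \<le> potential T []" using cover_init[OF assms(1)] by (simp add: potential_def)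
  also have "\<dots> \<le> measure_pmf.expectation ?p (potential T)"
    using assms(1) sched by (intro expectation_potential_rounds) auto
  also have "\<dots> \<le> measure_pmf.expectation ?p (\<lambda>h. f T / 50 + 27 / 10 * f (kept h))"
  proof (intro integral_mono_AE integrable_measure_pmf_finite finite_set_pmf_rounds)
    have "potential T h \<le> f T / 50 + 27 / 10 * f (kept h)" if h: "h \<in> set_pmf ?p" for h
    proof (rule potential_le)
      show "valid_history N f h" using valid_rounds[OF _ h] by simp
      show "card (chosen h) \<le> k" using card_rounds[OF _ h] by simp
      show "settled k t u h" unfolding u_def by (rule settled_schedule[OF h assms(7) t(3)])
      show "0 < \<theta>" if "\<theta> \<in> thresholds h" for \<theta>
        using that thresholds_rounds[OF h] sched by auto
    qed (use assms t u in auto)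
    then show "AE h in measure_pmf ?p. potential T h \<le> f T / 50 + 27 / 10 * f (kept h)"
      by (simp add: AE_measure_pmf_iff)
  qed
  also have "\<dots> = f T / 50 + 27 / 10 * measure_pmf.expectation ?p (\<lambda>h. f (kept h))"
    by (subst Bochner_Integration.integral_add)
       (auto intro!: integrable_measure_pmf_finite finite_set_pmf_rounds)
  \<comment> \<open>From \<open>f T / 2 - f T / 50 = 12/25 * f T\<close> the ratio is
    \<open>(27/10) / (12/25) = 5.625\<close>.\<close>
  finally show ?thesis using V by (simp add: field_simps)
qed

end

section \<open>The oracle algorithm\<close>

definition enum :: "'b set \<Rightarrow> 'b list" where
  "enum Q = (SOME qs. set qs = Q \<and> distinct qs)"

text \<open>The answers are passed on as a set function with value 0 outside \<open>Q\<close>, so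
  that the continuation can reuse \<open>candidates\<close> and \<open>walk\<close>
  unchanged.\<close>

definition ask :: "'a set set \<Rightarrow> (('a set \<Rightarrow> real) \<Rightarrow> ('a, 'r) oracle_alg) \<Rightarrow> ('a, 'r) oracle_alg" where
  "ask Q c = Query (enum Q)
     (\<lambda>vs. c (\<lambda>q. case map_of (zip (enum Q) vs) q of None \<Rightarrow> 0 | Some v \<Rightarrow> v))"

definition scan_queries :: "'a set \<Rightarrow> 'a history \<Rightarrow> 'a set set" where
  "scan_queries N h = insert (chosen h) ((\<lambda>x. insert x (chosen h)) ` N)"

definition grid_queries :: "nat \<Rightarrow> 'a set \<Rightarrow> nat \<Rightarrow> 'a set \<Rightarrow> 'a set set" where
  "grid_queries k X a S = (if a \<in> grid \<and> a \<le> k then (\<lambda>y. insert y S) ` X else {})"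

text \<open>Stopping depends on the answers, so the queries follow the draws to their end. Test
  queries are added only after an acceptance, which is when \<open>a\<close> changes; the test at
  \<open>a = 0\<close> is left to \<open>batch_queries\<close>.\<close>

fun walk_queries :: "nat \<Rightarrow> 'a set \<Rightarrow> nat \<Rightarrow> 'a set \<Rightarrow> ('a \<times> bool) list \<Rightarrow> 'a set set" where
  "walk_queries k X a S [] = {}"
| "walk_queries k X a S ((x, False) # xs) = {S, insert x S} \<union> walk_queries k X a S xs"
| "walk_queries k X a S ((x, True) # xs) =
     {S, insert x S} \<union> grid_queries k X (Suc a) (insert x S) \<union>
     walk_queries k X (Suc a) (insert x S) xs"

definition batch_queries :: "nat \<Rightarrow> 'a set \<Rightarrow> 'a set \<Rightarrow> ('a \<times> bool) list \<Rightarrow> 'a set set" where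
  "batch_queries k X S xs = grid_queries k X 0 S \<union> walk_queries k X 0 S xs"

definition best :: "nat \<Rightarrow> (nat \<Rightarrow> real) \<Rightarrow> nat" where
  "best G v = (SOME i. i \<le> G \<and> (\<forall>j\<le>G. v j \<le> v i))"

text \<open>The guesses \<open>2 ^ i\<close>, \<open>i \<le> G\<close>, of the scale of the thresholds are processed in parallel.\<close>

primrec search :: "'a set \<Rightarrow> nat \<Rightarrow> nat \<Rightarrow> real list \<Rightarrow> (nat \<Rightarrow> 'a history) \<Rightarrow>
    ('a, 'a set) oracle_alg" where
  "search N k G [] hs =
     ask ((\<lambda>i. kept (hs i)) ` {..G}) (\<lambda>v. Return (kept (hs (best G (\<lambda>i. v (kept (hs i)))))))"
| "search N k G (\<theta> # \<theta>s) hs =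
     ask (\<Union>i\<le>G. scan_queries N (hs i)) (\<lambda>v.
       let X = \<lambda>i. candidates v N (2 ^ i * \<theta>) (hs i) in
       Flip (map_pmf
         (\<lambda>D. ask (\<Union>i\<le>G. batch_queries k (X i) (chosen (hs i)) (D i))
           (\<lambda>w. search N k G \<theta>s (\<lambda>i. walk w k (X i) (2 ^ i * \<theta>) 0 (hs i) (D i))))
         (Pi_pmf {..G} [] (\<lambda>i. draws (batch_size (X i)) (X i)))))"

definition guesses :: "nat \<Rightarrow> nat" where
  "guesses k = nat \<lceil>log 2 k\<rceil>"

definition bits :: "nat \<Rightarrow> nat" where
  "bits n = nat \<lfloor>log 2 n\<rfloor> + 1"

text \<open>The empty set is included because it may be optimal; otherwise subadditivity bounds the
  optimum by singleton values.\<close>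

definition singles :: "'a set \<Rightarrow> 'a set set" where
  "singles N = insert {} ((\<lambda>x. {x}) ` N)"

text \<open>Capping \<open>k\<close> at \<open>card N\<close> keeps the number of queries polynomial
  in \<open>card N\<close> alone. Guess \<open>i\<close> starts at the threshold
  \<open>2 ^ i * 10 * M / k\<close>, with \<open>M\<close> the best value on
  \<open>singles N\<close>.\<close>

definition parallel_alg :: "'a subset_alg" where
  "parallel_alg N k0 =
     (if N = {} then Return {}
      else let k = min k0 (card N) in
        ask (singles N) (\<lambda>v. search N k (guesses k)
          (schedule (7 * bits (card N)) (10 * Max (v ` singles N) / k)) (\<lambda>i. [])))"

lemma enum:
  assumes "finite Q"
  shows "set (enum Q) = Q" "length (enum Q) = card Q"
proof -
  have *: "set (enum Q) = Q \<and> distinct (enum Q)"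
    unfolding enum_def using finite_distinct_list[OF assms] by (rule someI_ex)
  then show "set (enum Q) = Q" "length (enum Q) = card Q"
    using distinct_card[of "enum Q"] by auto
qed

lemma map_of_zip_map': "map_of (zip qs (map f qs)) q = (if q \<in> set qs then Some (f q) else None)"
  by (induction qs) auto

lemma exec_ask:
  assumes "finite Q"
  shows "exec f (ask Q c) = map_pmf (\<lambda>(r, tr). (r, enum Q # tr)) (exec f (c (\<lambda>q. if q \<in> Q then f q else 0)))"
proof -
  have "(\<lambda>q. case map_of (zip (enum Q) (map f (enum Q))) q of None \<Rightarrow> 0 | Some v \<Rightarrow> v) =
      (\<lambda>q. if q \<in> Q then f q else 0)"
    by (auto simp: map_of_zip_map' enum[OF assms])
  then show ?thesis unfolding ask_def exec.simps by (simp only:)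
qed

lemma best:
  assumes "j \<le> G"
  shows "best G v \<le> G" "v j \<le> v (best G v)"
proof -
  have "Max (v ` {..G}) \<in> v ` {..G}" by (intro Max_in) auto
  then obtain i where i: "Max (v ` {..G}) = v i" "i \<in> {..G}" by (rule imageE)
  have "v j \<le> v i" if "j \<le> G" for j unfolding i(1)[symmetric] using that by (intro Max_ge) auto
  with i(2) have "i \<le> G \<and> (\<forall>j\<le>G. v j \<le> v i)" by simp
  then have "best G v \<le> G \<and> (\<forall>j\<le>G. v j \<le> v (best G v))" unfolding best_def by (rule someI)
  then show "best G v \<le> G" "v j \<le> v (best G v)" using assms by auto
qed

text \<open>The walk consults only listed sets. Since \<open>a \<le> card (chosen h)\<close>, a test
  made before \<open>k\<close> elements are chosen has \<open>a \<le> k\<close>, as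
  \<open>grid_queries\<close> requires.\<close>

lemma walk_cong:
  assumes "\<And>q. q \<in> grid_queries k X a (chosen h) \<union> walk_queries k X a (chosen h) xs \<Longrightarrow> w q = f q"
    and "a \<le> card (chosen h)" "distinct (map fst xs)" "fst ` set xs \<inter> seen h = {}"
  shows "walk w k X \<theta> a h xs = walk f k X \<theta> a h xs"
  using assms
proof (induction xs arbitrary: a h)
  case (Cons p xs)
  obtain x c where p: "p = (x, c)" by (cases p)
  define S where "S = chosen h"
  have S: "w S = f S" "w (insert x S) = f (insert x S)"
    using Cons.prems(1) p unfolding S_def by (cases c; simp)+
  then have m: "marg w S x = marg f S x" by (simp add: marg_def)
  have stop: "stop w k X \<theta> a S = stop f k X \<theta> a S"
  proof (cases "card S < k \<and> a \<in> grid")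
    case True
    then have "a \<le> k" using Cons.prems(2) by (simp add: S_def)
    then have "w (insert y S) = f (insert y S)" if "y \<in> X" for y
      using Cons.prems(1)[of "insert y S"] that True by (simp add: grid_queries_def S_def)
    then have "{y \<in> X. marg w S y < \<theta>} = {y \<in> X. marg f S y < \<theta>}"
      using S by (auto simp: marg_def)
    then show ?thesis by (simp add: stop_def)
  qed (auto simp: stop_def)
  have x: "x \<notin> chosen h" using Cons.prems(4) p chosen_subset_seen[of h] by auto
  have "walk w k X \<theta> (if c then Suc a else a) ((x, c, marg f S x, \<theta>) # h) xs =
      walk f k X \<theta> (if c then Suc a else a) ((x, c, marg f S x, \<theta>) # h) xs"
  proof (rule Cons.IH)
    show "w q = f q" if "q \<in> grid_queries k X (if c then Suc a else a) (chosen ((x, c, marg f S x, \<theta>) # h))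
        \<union> walk_queries k X (if c then Suc a else a) (chosen ((x, c, marg f S x, \<theta>) # h)) xs" for q
      using that p by (intro Cons.prems(1)) (cases c; auto)
    show "(if c then Suc a else a) \<le> card (chosen ((x, c, marg f S x, \<theta>) # h))"
      using Cons.prems(2) x by simp
  qed (use Cons.prems(3,4) p in auto)
  then show ?case using p stop m by (simp add: S_def)
qed simp

lemma finite_grid_queries: "finite X \<Longrightarrow> finite (grid_queries k X a S)"
  by (simp add: grid_queries_def)

lemma finite_walk_queries: "finite X \<Longrightarrow> finite (walk_queries k X a S xs)"
  by (induction k X a S xs rule: walk_queries.induct) (auto simp: finite_grid_queries)

text \<open>The second factor is 0 or 1. Written as a cardinality, it adds up over successive
  \<open>a\<close> to the number of grid points up to \<open>k\<close>.\<close>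

lemma card_grid_queries:
  assumes "finite X"
  shows "card (grid_queries k X a S) \<le> card X * card (grid \<inter> {a} \<inter> {..k})"
  using assms card_image_le[of X "\<lambda>y. insert y S"] by (auto simp: grid_queries_def)

lemma card_walk_queries:
  assumes "finite X"
  shows "card (walk_queries k X a S xs) \<le> 2 * length xs + card X * card (grid \<inter> {a<..k})"
  using assms
proof (induction k X a S xs rule: walk_queries.induct)
  case (2 k X a S x xs)
  have "card (walk_queries k X a S ((x, False) # xs)) \<le> card {S, insert x S} + card (walk_queries k X a S xs)"
    by (simp only: walk_queries.simps card_Un_le)
  moreover have "card {S, insert x S} \<le> 2" by (simp add: card_insert_if)
  ultimately show ?case using 2 by simp
next
  case (3 k X a S x xs)
  have "card (walk_queries k X a S ((x, True) # xs)) \<le> card ({S, insert x S} \<union> grid_queries k X (Suc a) (insert x S))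
      + card (walk_queries k X (Suc a) (insert x S) xs)"
    by (simp only: walk_queries.simps card_Un_le)
  moreover have "card ({S, insert x S} \<union> grid_queries k X (Suc a) (insert x S)) \<le>
      card {S, insert x S} + card (grid_queries k X (Suc a) (insert x S))"
    by (rule card_Un_le)
  moreover have "card {S, insert x S} \<le> 2" by (simp add: card_insert_if)
  moreover have "card (grid_queries k X (Suc a) (insert x S)) \<le> card X * card (grid \<inter> {Suc a} \<inter> {..k})"
    by (rule card_grid_queries[OF 3(2)])
  moreover have "card (grid \<inter> {a<..k}) = card (grid \<inter> {Suc a} \<inter> {..k}) + card (grid \<inter> {Suc a<..k})"
    by (subst card_Un_disjoint[symmetric]) (auto intro!: arg_cong[of _ _ card])
  ultimately show ?case using 3 by (simp add: distrib_left)
qed simp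

lemma card_batch_queries:
  assumes "finite X"
  shows "card (batch_queries k X S xs) \<le> 2 * length xs + card X * card (grid \<inter> {..k})"
proof -
  have "card (batch_queries k X S xs) \<le> card (grid_queries k X 0 S) + card (walk_queries k X 0 S xs)"
    unfolding batch_queries_def by (rule card_Un_le)
  moreover have "card (grid_queries k X 0 S) \<le> card X * card (grid \<inter> {0} \<inter> {..k})"
    by (rule card_grid_queries[OF assms])
  moreover have "card (walk_queries k X 0 S xs) \<le> 2 * length xs + card X * card (grid \<inter> {0<..k})"
    by (rule card_walk_queries[OF assms])
  moreover have "card (grid \<inter> {..k}) = card (grid \<inter> {0} \<inter> {..k}) + card (grid \<inter> {0<..k})"
    by (subst card_Un_disjoint[symmetric]) (auto intro!: arg_cong[of _ _ card])
  ultimately show ?thesis by (simp add: distrib_left)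
qed

lemma walk_queries_subset:
  assumes "S \<subseteq> N" "X \<subseteq> N" "fst ` set xs \<subseteq> N"
  shows "walk_queries k X a S xs \<subseteq> Pow N"
  using assms by (induction k X a S xs rule: walk_queries.induct) (auto simp: grid_queries_def)

lemma batch_queries_subset:
  assumes "S \<subseteq> N" "X \<subseteq> N" "fst ` set xs \<subseteq> N"
  shows "batch_queries k X S xs \<subseteq> Pow N"
  using walk_queries_subset[OF assms] assms by (auto simp: batch_queries_def grid_queries_def)

lemma card_scan_queries: "finite N \<Longrightarrow> card (scan_queries N h) \<le> card N + 1"
  using card_image_le[of N "\<lambda>x. insert x (chosen h)"]
  by (auto simp: scan_queries_def card_insert_if le_SucI)

lemma candidates_cong:
  assumes "\<And>q. q \<in> scan_queries N h \<Longrightarrow> v q = f q"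
  shows "candidates v N \<theta> h = candidates f N \<theta> h"
  using assms by (auto simp: candidates_def marg_def scan_queries_def)

lemma card_UN_atMost_le:
  assumes "\<And>i. i \<le> G \<Longrightarrow> card (A i) \<le> b"
  shows "card (\<Union>i\<le>G. A i) \<le> (G + 1) * b"
proof -
  have "card (\<Union>i\<le>G. A i) \<le> (\<Sum>i\<le>G. card (A i))" by (rule card_UN_le) simp
  also have "\<dots> \<le> (\<Sum>i\<le>G. b)" by (intro sum_mono assms) simp
  finally show ?thesis by simp
qed

section \<open>Behaviour and cost of the parallel search\<close>

context submodular_instance
begin

definition batches :: "nat \<Rightarrow> real \<Rightarrow> (nat \<Rightarrow> 'a history) \<Rightarrow> (nat \<Rightarrow> ('a \<times> bool) list) pmf" where
  "batches G \<theta> hs = Pi_pmf {..G} [] (\<lambda>i.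
     draws (batch_size (candidates f N (2 ^ i * \<theta>) (hs i))) (candidates f N (2 ^ i * \<theta>) (hs i)))"

definition advance :: "nat \<Rightarrow> real \<Rightarrow> (nat \<Rightarrow> 'a history) \<Rightarrow> (nat \<Rightarrow> ('a \<times> bool) list) \<Rightarrow>
    nat \<Rightarrow> 'a history" where
  "advance k \<theta> hs D i = walk f k (candidates f N (2 ^ i * \<theta>) (hs i)) (2 ^ i * \<theta>) 0 (hs i) (D i)"

lemma batchesD:
  assumes "D \<in> set_pmf (batches G \<theta> hs)"
  shows "i \<le> G \<Longrightarrow> D i \<in> set_pmf
      (draws (batch_size (candidates f N (2 ^ i * \<theta>) (hs i))) (candidates f N (2 ^ i * \<theta>) (hs i)))"
    and "\<not> i \<le> G \<Longrightarrow> D i = []"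
  using assms unfolding batches_def set_Pi_pmf[OF finite_atMost] PiE_dflt_def by auto

lemma finite_set_pmf_batches: "finite (set_pmf (batches G \<theta> hs))"
  unfolding batches_def set_Pi_pmf[OF finite_atMost]
  by (intro finite_PiE_dflt) (auto intro!: finite_set_pmf_draws finite_candidates batch_size_le)

lemma map_batches:
  assumes "i \<le> G"
  shows "map_pmf (\<lambda>D. D i) (batches G \<theta> hs) =
    draws (batch_size (candidates f N (2 ^ i * \<theta>) (hs i))) (candidates f N (2 ^ i * \<theta>) (hs i))"
  unfolding batches_def using assms by (subst Pi_pmf_component) auto

text \<open>One threshold costs two rounds, a scan for the candidates and a batch. The partial
  answers agree with \<open>f\<close> on everything inspected, so the run can be described by
  \<open>f\<close> itself.\<close>

lemma exec_search_Cons: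
  "exec f (search N k G (\<theta> # \<theta>s) hs) =
     map_pmf (\<lambda>(r, tr). (r, enum (\<Union>i\<le>G. scan_queries N (hs i)) # tr))
       (batches G \<theta> hs \<bind> (\<lambda>D.
         map_pmf (\<lambda>(r, tr). (r, enum (\<Union>i\<le>G. batch_queries k
             (candidates f N (2 ^ i * \<theta>) (hs i)) (chosen (hs i)) (D i)) # tr))
           (exec f (search N k G \<theta>s (advance k \<theta> hs D)))))"
proof -
  define Q1 where "Q1 = (\<Union>i\<le>G. scan_queries N (hs i))"
  define v where "v = (\<lambda>q. if q \<in> Q1 then f q else 0)"
  define Y where "Y = (\<lambda>i. candidates v N (2 ^ i * \<theta>) (hs i))"
  define X where "X = (\<lambda>i. candidates f N (2 ^ i * \<theta>) (hs i))"
  have finQ1: "finite Q1" unfolding Q1_def scan_queries_def using finite_ground by auto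
  have YX: "Y i = X i" if "i \<le> G" for i
    unfolding Y_def X_def using that by (intro candidates_cong) (auto simp: v_def Q1_def)
  have finX: "finite (X i)" for i unfolding X_def by (rule finite_candidates)
  define step where "step = (\<lambda>D. ask (\<Union>i\<le>G. batch_queries k (Y i) (chosen (hs i)) (D i))
    (\<lambda>w. search N k G \<theta>s (\<lambda>i. walk w k (Y i) (2 ^ i * \<theta>) 0 (hs i) (D i))))"
  have exec_step: "exec f (step D) =
      map_pmf (\<lambda>(r, tr). (r, enum (\<Union>i\<le>G. batch_queries k (X i) (chosen (hs i)) (D i)) # tr))
        (exec f (search N k G \<theta>s (advance k \<theta> hs D)))"
    if D: "D \<in> set_pmf (batches G \<theta> hs)" for D
  proof -
    define Q2 where "Q2 = (\<Union>i\<le>G. batch_queries k (Y i) (chosen (hs i)) (D i))"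
    have Q2: "Q2 = (\<Union>i\<le>G. batch_queries k (X i) (chosen (hs i)) (D i))"
      unfolding Q2_def using YX by auto
    have finQ2: "finite Q2"
      unfolding Q2 batch_queries_def using finX by (auto intro: finite_grid_queries finite_walk_queries)
    define w where "w = (\<lambda>q. if q \<in> Q2 then f q else 0)"
    have "walk w k (Y i) (2 ^ i * \<theta>) 0 (hs i) (D i) = advance k \<theta> hs D i" for i
    proof (cases "i \<le> G")
      case True
      note d = draws_candidates[OF batchesD(1)[OF D True]]
      have "walk w k (X i) (2 ^ i * \<theta>) 0 (hs i) (D i) = walk f k (X i) (2 ^ i * \<theta>) 0 (hs i) (D i)"
      proof (rule walk_cong)
        show "w q = f q" if "q \<in> grid_queries k (X i) 0 (chosen (hs i)) \<union>
            walk_queries k (X i) 0 (chosen (hs i)) (D i)" for q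
          using that True by (auto simp: w_def Q2 batch_queries_def)
        show "fst ` set (D i) \<inter> seen (hs i) = {}"
          using d(3) candidates_subset[of f N "2 ^ i * \<theta>" "hs i"] by blast
      qed (use d(2) in auto)
      then show ?thesis using YX[OF True] by (simp add: advance_def X_def)
    next
      case False
      \<comment> \<open>Beyond \<open>G\<close> the draws are the default \<open>[]\<close>, and
        such a walk returns its history whatever the oracle is.\<close>
      then show ?thesis using batchesD(2)[OF D False] by (simp add: advance_def)
    qed
    then have "(\<lambda>i. walk w k (Y i) (2 ^ i * \<theta>) 0 (hs i) (D i)) = advance k \<theta> hs D" by auto
    then show ?thesis
      unfolding step_def Q2_def[symmetric] exec_ask[OF finQ2] w_def[symmetric] Q2[symmetric]
      by (simp only:)
  qed
  have Pi: "Pi_pmf {..G} [] (\<lambda>i. draws (batch_size (Y i)) (Y i)) = batches G \<theta> hs"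
    unfolding batches_def X_def[symmetric] using YX by (intro Pi_pmf_cong) (auto simp: X_def)
  have "exec f (search N k G (\<theta> # \<theta>s) hs) =
      map_pmf (\<lambda>(r, tr). (r, enum Q1 # tr)) (exec f (Flip (map_pmf step (batches G \<theta> hs))))"
    unfolding search.simps Q1_def[symmetric] exec_ask[OF finQ1] v_def[symmetric] Let_def
      Pi[symmetric] step_def Y_def ..
  also have "exec f (Flip (map_pmf step (batches G \<theta> hs))) = batches G \<theta> hs \<bind> (\<lambda>D. exec f (step D))"
    by (simp add: bind_eq_join_pmf map_pmf_comp)
  also have "\<dots> = batches G \<theta> hs \<bind> (\<lambda>D.
      map_pmf (\<lambda>(r, tr). (r, enum (\<Union>i\<le>G. batch_queries k (X i) (chosen (hs i)) (D i)) # tr))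
        (exec f (search N k G \<theta>s (advance k \<theta> hs D))))"
    by (intro bind_pmf_cong refl exec_step)
  finally show ?thesis unfolding Q1_def X_def .
qed

lemma exec_search_Nil:
  "exec f (search N k G [] hs) =
     return_pmf (kept (hs (best G (\<lambda>i. f (kept (hs i))))), [enum ((\<lambda>i. kept (hs i)) ` {..G})])"
proof -
  let ?Q = "(\<lambda>i. kept (hs i)) ` {..G}"
  let ?v = "\<lambda>q. if q \<in> ?Q then f q else 0"
  have "best G (\<lambda>i. ?v (kept (hs i))) = best G (\<lambda>i. f (kept (hs i)))"
  proof -
    have "(i \<le> G \<and> (\<forall>j\<le>G. ?v (kept (hs j)) \<le> ?v (kept (hs i)))) =
        (i \<le> G \<and> (\<forall>j\<le>G. f (kept (hs j)) \<le> f (kept (hs i))))" for i by auto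
    then show ?thesis unfolding best_def by (simp only:)
  qed
  then show ?thesis unfolding search.simps by (subst exec_ask) simp_all
qed

lemma finite_set_pmf_search: "finite (set_pmf (exec f (search N k G \<theta>s hs)))"
proof (induction \<theta>s arbitrary: hs)
  case Nil
  show ?case unfolding exec_search_Nil by simp
next
  case (Cons \<theta> \<theta>s)
  show ?case unfolding exec_search_Cons set_map_pmf set_bind_pmf
    by (intro finite_imageI finite_UN_I finite_set_pmf_batches Cons)
qed

text \<open>Coordinate \<open>i\<close> of the parallel run is distributed like
  \<open>rounds\<close> for guess \<open>i\<close>, and in every outcome the final choice is at
  least as good as that coordinate.\<close>

lemma expectation_search_ge:
  assumes "i \<le> G"
  shows "measure_pmf.expectation (rounds f N k (map ((*) (2 ^ i)) \<theta>s) (hs i)) (\<lambda>h. f (kept h))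
    \<le> measure_pmf.expectation (exec f (search N k G \<theta>s hs)) (\<lambda>(S, tr). f S)"
proof (induction \<theta>s arbitrary: hs)
  case Nil
  have "f (kept (hs i)) \<le> f (kept (hs (best G (\<lambda>i. f (kept (hs i))))))"
    by (rule best(2)[OF assms, of "\<lambda>i. f (kept (hs i))"])
  then show ?case unfolding exec_search_Nil by simp
next
  case (Cons \<theta> \<theta>s)
  note fin = finite_set_pmf_batches[of G \<theta> hs]
  let ?X = "candidates f N (2 ^ i * \<theta>) (hs i)"
  let ?E = "\<lambda>h. measure_pmf.expectation (rounds f N k (map ((*) (2 ^ i)) \<theta>s) h) (\<lambda>h. f (kept h))"
  have "measure_pmf.expectation (rounds f N k (map ((*) (2 ^ i)) (\<theta> # \<theta>s)) (hs i)) (\<lambda>h. f (kept h)) =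
      measure_pmf.expectation (draws (batch_size ?X) ?X) (\<lambda>xs. ?E (walk f k ?X (2 ^ i * \<theta>) 0 (hs i) xs))"
    unfolding list.map expectation_rounds_Cons ..
  also have "\<dots> = measure_pmf.expectation (batches G \<theta> hs) (\<lambda>D. ?E (advance k \<theta> hs D i))"
    unfolding map_batches[OF assms, symmetric] integral_map_pmf advance_def ..
  also have "\<dots> \<le> measure_pmf.expectation (batches G \<theta> hs) (\<lambda>D.
      measure_pmf.expectation (exec f (search N k G \<theta>s (advance k \<theta> hs D))) (\<lambda>(S, tr). f S))"
    by (intro integral_mono integrable_measure_pmf_finite fin Cons)
  also have "\<dots> = measure_pmf.expectation (exec f (search N k G (\<theta> # \<theta>s) hs)) (\<lambda>(S, tr). f S)"
  proof -
    let ?g = "\<lambda>D. map_pmf (\<lambda>(r, tr). (r, enum (\<Union>i\<le>G. batch_queries k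
        (candidates f N (2 ^ i * \<theta>) (hs i)) (chosen (hs i)) (D i)) # tr))
      (exec f (search N k G \<theta>s (advance k \<theta> hs D)))"
    have "measure_pmf.expectation (exec f (search N k G (\<theta> # \<theta>s) hs)) (\<lambda>(S, tr). f S) =
        measure_pmf.expectation (batches G \<theta> hs \<bind> ?g) (\<lambda>(S, tr). f S)"
      unfolding exec_search_Cons integral_map_pmf case_prod_unfold by simp
    also have "\<dots> = (\<Sum>D\<in>set_pmf (batches G \<theta> hs). pmf (batches G \<theta> hs) D *\<^sub>R
        measure_pmf.expectation (?g D) (\<lambda>(S, tr). f S))"
      by (rule pmf_expectation_bind[OF fin _ subset_refl]) (simp add: finite_set_pmf_search)
    also have "\<dots> = measure_pmf.expectation (batches G \<theta> hs)
        (\<lambda>D. measure_pmf.expectation (?g D) (\<lambda>(S, tr). f S))"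
      by (rule integral_measure_pmf[OF fin, symmetric])
    also have "\<dots> = measure_pmf.expectation (batches G \<theta> hs) (\<lambda>D.
        measure_pmf.expectation (exec f (search N k G \<theta>s (advance k \<theta> hs D))) (\<lambda>(S, tr). f S))"
      unfolding integral_map_pmf case_prod_unfold by simp
    finally show ?thesis by (rule sym)
  qed
  finally show ?case .
qed

lemma search_cost:
  assumes "\<And>i. i \<le> G \<Longrightarrow> valid_history N f (hs i)" "\<And>i. i \<le> G \<Longrightarrow> card (chosen (hs i)) \<le> k"
    and "(S, tr) \<in> set_pmf (exec f (search N k G \<theta>s hs))"
  shows "S \<subseteq> N \<and> card S \<le> k \<and> length tr = 2 * length \<theta>s + 1 \<and> (\<forall>qs\<in>set tr. set qs \<subseteq> Pow N) \<and>
    length (concat tr) \<le>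
      length \<theta>s * ((G + 1) * (card N + 1) + (G + 1) * (2 * card N + card N * card (grid \<inter> {..k})))
      + (G + 1)"
  using assms
proof (induction \<theta>s arbitrary: hs S tr)
  case Nil
  let ?i = "best G (\<lambda>i. f (kept (hs i)))"
  let ?Q = "(\<lambda>i. kept (hs i)) ` {..G}"
  have i: "?i \<le> G" by (rule best(1)[of 0]) simp
  have St: "S = kept (hs ?i)" "tr = [enum ?Q]"
    using Nil.prems(3) unfolding exec_search_Nil by auto
  have "S \<subseteq> N" unfolding St by (rule valid_kept_subset[OF Nil.prems(1)[OF i]])
  moreover have "card S \<le> k"
    unfolding St using card_mono[OF finite_chosen kept_subset_chosen] Nil.prems(2)[OF i] by (rule le_trans)
  moreover have "?Q \<subseteq> Pow N" using valid_kept_subset Nil.prems(1) by auto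
  moreover have "card ?Q \<le> G + 1" using card_image_le[of "{..G}" "\<lambda>i. kept (hs i)"] by simp
  ultimately show ?case unfolding St(2) by (simp add: enum)
next
  case (Cons \<theta> \<theta>s)
  let ?X = "\<lambda>i. candidates f N (2 ^ i * \<theta>) (hs i)"
  let ?Q1 = "\<Union>i\<le>G. scan_queries N (hs i)"
  obtain D tr' where D: "D \<in> set_pmf (batches G \<theta> hs)"
    and tr': "(S, tr') \<in> set_pmf (exec f (search N k G \<theta>s (advance k \<theta> hs D)))"
    and tr: "tr = enum ?Q1 # enum (\<Union>i\<le>G. batch_queries k (?X i) (chosen (hs i)) (D i)) # tr'"
    using Cons.prems(3) unfolding exec_search_Cons by auto
  let ?Q2 = "\<Union>i\<le>G. batch_queries k (?X i) (chosen (hs i)) (D i)"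
  have IH: "S \<subseteq> N \<and> card S \<le> k \<and> length tr' = 2 * length \<theta>s + 1 \<and> (\<forall>qs\<in>set tr'. set qs \<subseteq> Pow N) \<and>
    length (concat tr') \<le>
      length \<theta>s * ((G + 1) * (card N + 1) + (G + 1) * (2 * card N + card N * card (grid \<inter> {..k})))
      + (G + 1)"
  proof (rule Cons.IH[OF _ _ tr'])
    fix i assume i: "i \<le> G"
    show "valid_history N f (advance k \<theta> hs D i)"
      unfolding advance_def by (rule valid_round[OF Cons.prems(1)[OF i] batchesD(1)[OF D i]])
    show "card (chosen (advance k \<theta> hs D i)) \<le> k"
      unfolding advance_def by (rule card_chosen_walk[OF Cons.prems(2)[OF i]])
  qed
  have chosenN: "chosen (hs i) \<subseteq> N" if "i \<le> G" for i
    by (rule valid_chosen_subset[OF Cons.prems(1)[OF that]])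
  have XN: "?X i \<subseteq> N" for i using candidates_subset by fast
  have Q1: "?Q1 \<subseteq> Pow N" using chosenN by (auto simp: scan_queries_def)
  have "batch_queries k (?X i) (chosen (hs i)) (D i) \<subseteq> Pow N" if i: "i \<le> G" for i
    using draws_candidates(3)[OF batchesD(1)[OF D i]] XN[of i]
    by (intro batch_queries_subset chosenN i) auto
  then have Q2: "?Q2 \<subseteq> Pow N" by blast
  have fin: "finite ?Q1" "finite ?Q2"
    using finite_ground finite_subset[OF Q1] finite_subset[OF Q2] by auto
  have "card ?Q1 \<le> (G + 1) * (card N + 1)"
    by (intro card_UN_atMost_le card_scan_queries finite_ground)
  moreover have "card ?Q2 \<le> (G + 1) * (2 * card N + card N * card (grid \<inter> {..k}))"
  proof (rule card_UN_atMost_le)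
    fix i assume i: "i \<le> G"
    have le: "card (?X i) \<le> card N" by (rule card_mono[OF finite_ground XN])
    have "card (batch_queries k (?X i) (chosen (hs i)) (D i)) \<le>
        2 * length (D i) + card (?X i) * card (grid \<inter> {..k})"
      by (rule card_batch_queries[OF finite_candidates])
    also have "\<dots> \<le> 2 * card N + card N * card (grid \<inter> {..k})"
      using draws_candidates(1)[OF batchesD(1)[OF D i]] batch_size_le[of "?X i"] le
      by (intro add_mono mult_le_mono) auto
    finally show "card (batch_queries k (?X i) (chosen (hs i)) (D i)) \<le>
      2 * card N + card N * card (grid \<inter> {..k})" .
  qed
  ultimately show ?case
    using IH Q1 Q2 unfolding tr by (simp add: enum[OF fin(1)] enum[OF fin(2)])
qed

end

section \<open>Approximation ratio and complexity\<close>

lemma lg_ge_1: "1 \<le> lg x"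
  by (simp add: lg_def)

lemma lg_mono: "1 \<le> x \<Longrightarrow> x \<le> y \<Longrightarrow> lg x \<le> lg y"
  unfolding lg_def by (intro max.mono) auto

lemma lg_le_self:
  assumes "1 \<le> k"
  shows "lg (real k) \<le> real k"
proof -
  have "log 2 (real k) \<le> real k" using assms by (intro log2_of_power_le) (auto simp: less_imp_le)
  then show ?thesis using assms by (simp add: lg_def)
qed

lemma less_power_bits: "1 \<le> n \<Longrightarrow> n < 2 ^ bits n"
proof -
  assume n: "1 \<le> n"
  then have "0 \<le> log 2 (real n)" by simp
  then have "log 2 (real n) < real (bits n)" unfolding bits_def by linarith
  then have "real n < 2 powr real (bits n)" using n by (simp add: log_less_iff)
  then have "real n < real (2 ^ bits n)" by (simp add: powr_realpow)
  then show ?thesis by (simp only: of_nat_less_iff)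
qed

lemma bits_le: "1 \<le> n \<Longrightarrow> real (bits n) \<le> 2 * lg n"
proof -
  assume "1 \<le> n"
  then have "0 \<le> log 2 (real n)" by simp
  then have "real (bits n) \<le> log 2 (real n) + 1" unfolding bits_def by linarith
  then show ?thesis unfolding lg_def by linarith
qed

lemma guesses_le: "1 \<le> k \<Longrightarrow> real (guesses k + 1) \<le> 3 * lg k"
proof -
  assume "1 \<le> k"
  then have "0 \<le> log 2 (real k)" by simp
  then have "real (guesses k) \<le> log 2 (real k) + 1" unfolding guesses_def by linarith
  then show ?thesis unfolding lg_def by simp
qed

lemma length_schedule: "length (schedule R t) = 80 * R"
  by (simp add: schedule_def length_concat comp_def sum_list_triv)

lemma map_schedule: "map ((*) a) (schedule R t) = schedule R (a * t)"
  by (simp add: schedule_def map_concat comp_def mult.assoc)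

text \<open>The ratio \<open>v / m\<close> lies between 1 and \<open>k\<close>; it is rounded up to
  a power of two.\<close>

lemma ex_power_scale:
  fixes v m :: real
  assumes "0 < m" "m \<le> v" "v \<le> k * m" "1 \<le> k"
  shows "\<exists>i\<le>guesses k. v \<le> 2 ^ i * m \<and> 2 ^ i * m \<le> 2 * v"
proof -
  define x where "x = v / m"
  have x: "1 \<le> x" "x \<le> k" using assms by (auto simp: x_def field_simps)
  define i where "i = nat \<lceil>log 2 x\<rceil>"
  have "0 \<le> log 2 x" using x by simp
  then have i: "log 2 x \<le> real i" "real i \<le> log 2 x + 1" unfolding i_def by linarith+
  have "log 2 x \<le> log 2 k" using x by simp
  then have "i \<le> guesses k" unfolding i_def guesses_def by (intro nat_mono ceiling_mono)
  moreover have "2 powr (log 2 x) \<le> 2 powr real i" using i(1) by simp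
  then have "x \<le> 2 ^ i" using x by (simp add: powr_realpow)
  then have "v \<le> 2 ^ i * m" using assms(1) by (simp add: x_def field_simps)
  moreover have "2 powr real i \<le> 2 powr (log 2 x + 1)" using i(2) by simp
  then have "2 ^ i \<le> 2 * x" using x by (simp add: powr_realpow powr_add)
  then have "2 ^ i * m \<le> 2 * v" using assms(1) by (simp add: x_def field_simps)
  ultimately show ?thesis by blast
qed

context submodular_instance
begin

lemma value_le_sum_singles:
  assumes "T \<subseteq> N" "T \<noteq> {}"
  shows "f T \<le> (\<Sum>x\<in>T. f {x})"
proof -
  have "finite T" using assms(1) finite_ground by (rule finite_subset)
  then show ?thesis using assms(2,1)
  proof (induction T rule: finite_ne_induct)
    case (insert x T)
    have "f ({x} \<union> T) \<le> f {x} + f T" using insert.prems by (intro subadditive) auto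
    with insert show ?case by simp
  qed simp
qed

lemma exec_parallel_alg:
  assumes "N \<noteq> {}"
  shows "exec f (parallel_alg N k0) = map_pmf (\<lambda>(r, tr). (r, enum (singles N) # tr))
    (exec f (search N (min k0 (card N)) (guesses (min k0 (card N)))
      (schedule (7 * bits (card N)) (10 * Max (f ` singles N) / min k0 (card N))) (\<lambda>i. [])))"
proof -
  have fin: "finite (singles N)" using finite_ground by (simp add: singles_def)
  have "(\<lambda>q. if q \<in> singles N then f q else 0) ` singles N = f ` singles N" by auto
  then show ?thesis using assms by (simp only: parallel_alg_def if_False Let_def exec_ask[OF fin])
qed

lemma parallel_alg_cost:
  assumes "N \<noteq> {}" "1 \<le> k0" "(S, tr) \<in> set_pmf (exec f (parallel_alg N k0))"
  shows "S \<subseteq> N \<and> card S \<le> k0 \<and> (\<forall>qs\<in>set tr. set qs \<subseteq> Pow N) \<and>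
    real (length tr) \<le> 3000 * lg (card N) \<and>
    real (length (concat tr)) \<le> 300000 * (card N * lg (card N) * (lg (min k0 (card N)))\<^sup>2)"
proof -
  define n where "n = card N"
  define k where "k = min k0 n"
  define G where "G = guesses k"
  define b where "b = bits n"
  define g where "g = card (grid \<inter> {..k})"
  have n1: "1 \<le> n" using assms(1) finite_ground by (simp add: n_def Suc_le_eq card_gt_0_iff)
  have k1: "1 \<le> k" using n1 assms(2) by (simp add: k_def)
  have fin: "finite (singles N)" using finite_ground by (simp add: singles_def)
  have cs: "card (singles N) \<le> n + 1"
    using card_image_le[OF finite_ground, of "\<lambda>x. {x}"]
    by (auto simp: singles_def n_def card_insert_if finite_ground le_SucI)
  obtain tr' where tr': "(S, tr') \<in> set_pmf (exec f (search N k G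
        (schedule (7 * b) (10 * Max (f ` singles N) / k)) (\<lambda>i. [])))"
    and tr: "tr = enum (singles N) # tr'"
    using assms(3) unfolding exec_parallel_alg[OF assms(1)] k_def n_def G_def b_def by auto
  \<comment> \<open>The schedule has \<open>80 * 7 * b = 560 * b\<close> entries.\<close>
  have cost: "S \<subseteq> N \<and> card S \<le> k \<and> length tr' = 2 * (560 * b) + 1 \<and> (\<forall>qs\<in>set tr'. set qs \<subseteq> Pow N) \<and>
    length (concat tr') \<le> 560 * b * ((G + 1) * (n + 1) + (G + 1) * (2 * n + n * g)) + (G + 1)"
    using search_cost[OF _ _ tr'] by (simp add: length_schedule n_def g_def)
  have ln: "1 \<le> lg n" and lk: "1 \<le> lg k" by (rule lg_ge_1)+
  have b: "real b \<le> 2 * lg n" unfolding b_def by (rule bits_le[OF n1])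
  have G: "real (G + 1) \<le> 3 * lg k" unfolding G_def by (rule guesses_le[OF k1])
  have g: "real g \<le> 66 * lg k" unfolding g_def by (rule card_grid_le[OF k1])
  have rn: "1 \<le> real n" using n1 by simp
  have "real (length tr) = 1120 * real b + 2" using cost by (simp add: tr)
  then have rounds: "real (length tr) \<le> 3000 * lg n" using b ln by linarith
  have "length (concat tr) \<le> (n + 1) + (560 * b * ((G + 1) * (n + 1) + (G + 1) * (2 * n + n * g)) + (G + 1))"
    using cost cs by (simp add: tr enum[OF fin])
  then have "real (length (concat tr)) \<le>
      real ((n + 1) + (560 * b * ((G + 1) * (n + 1) + (G + 1) * (2 * n + n * g)) + (G + 1)))"
    by (simp only: of_nat_le_iff)
  also have "\<dots> = (real n + 1) + (560 * real b * (real (G + 1) * ((real n + 1) + (2 * real n + real n * real g))) + real (G + 1))"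
    by (simp add: algebra_simps)
  also have "\<dots> \<le> 2 * real n + (560 * (2 * lg n) * ((3 * lg k) * (70 * (real n * lg k))) + 3 * lg k)"
  proof -
    have "real n * real g \<le> real n * (66 * lg k)" using g by (intro mult_left_mono) auto
    then have "real n * real g \<le> 66 * (real n * lg k)" by (simp only: mult.left_commute)
    moreover have "real n * 1 \<le> real n * lg k" using lk by (intro mult_left_mono) auto
    ultimately have "(real n + 1) + (2 * real n + real n * real g) \<le> 70 * (real n * lg k)"
      using rn by argo
    then have 1: "real (G + 1) * ((real n + 1) + (2 * real n + real n * real g)) \<le> (3 * lg k) * (70 * (real n * lg k))"
      using G lk by (intro mult_mono) auto
    have 2: "560 * real b \<le> 560 * (2 * lg n)" using b by simp
    have "560 * real b * (real (G + 1) * ((real n + 1) + (2 * real n + real n * real g)))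
        \<le> 560 * (2 * lg n) * ((3 * lg k) * (70 * (real n * lg k)))"
      by (rule mult_mono[OF 2 1]) (use ln in simp_all)
    then show ?thesis using rn G by argo
  qed
  \<comment> \<open>The leading constant is \<open>560 * 2 * 3 * 70 = 235200\<close>; the
    lower-order terms fit into the rest.\<close>
  also have "\<dots> \<le> 300000 * (real n * lg n * (lg k)\<^sup>2)"
  proof -
    have "1 * 1 \<le> lg k * lg k" "1 * lg k \<le> lg k * lg k" using lk by (intro mult_mono; simp)+
    then have sq: "1 \<le> (lg k)\<^sup>2" "lg k \<le> (lg k)\<^sup>2" by (simp_all add: power2_eq_square)
    have "1 * 1 \<le> real n * lg n" "real n * 1 \<le> real n * lg n" using rn ln by (intro mult_mono; simp)+
    then have nl: "1 \<le> real n * lg n" "real n \<le> real n * lg n" by simp_all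
    have "real n * 1 \<le> real n * lg n * (lg k)\<^sup>2" using nl sq by (intro mult_mono) auto
    moreover have "1 * lg k \<le> real n * lg n * (lg k)\<^sup>2" using nl sq lk by (intro mult_mono) auto
    moreover have "560 * (2 * lg n) * ((3 * lg k) * (70 * (real n * lg k))) =
        235200 * (real n * lg n * (lg k)\<^sup>2)" by (simp add: power2_eq_square)
    ultimately show ?thesis using rn by linarith
  qed
  finally have queries: "real (length (concat tr)) \<le> 300000 * (real n * lg n * (lg k)\<^sup>2)" .
  have "set (enum (singles N)) \<subseteq> Pow N" unfolding enum(1)[OF fin] by (auto simp: singles_def)
  then have "\<forall>qs\<in>set tr. set qs \<subseteq> Pow N" using cost by (simp add: tr)
  moreover have "card S \<le> k0" using cost by (simp add: k_def)
  ultimately show ?thesis using cost rounds queries unfolding n_def k_def by simp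
qed

text \<open>The largest value \<open>M\<close> on \<open>singles N\<close> satisfies
  \<open>M \<le> OPT \<le> k * M\<close>, so some guess has \<open>2 ^ i * M\<close> between OPT and
  2 OPT. Its first threshold meets the conditions of \<open>expectation_kept_ge\<close>.\<close>

lemma parallel_alg_approximates:
  assumes "N \<noteq> {}" "1 \<le> k0"
  shows "OPT N k0 f \<le> 5.83 * measure_pmf.expectation (exec f (parallel_alg N k0)) (\<lambda>(S, tr). f S)"
proof -
  define k where "k = min k0 (card N)"
  have n1: "1 \<le> card N" using assms(1) finite_ground by (simp add: Suc_le_eq card_gt_0_iff)
  then have k1: "1 \<le> k" using assms(2) by (simp add: k_def)
  let ?F = "{T. T \<subseteq> N \<and> card T \<le> k0}"
  have finF: "finite ?F" using finite_ground by simp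
  have cardF: "card T \<le> k" if "T \<in> ?F" for T
    using that card_mono[OF finite_ground, of T] by (simp add: k_def)
  have "OPT N k0 f \<in> f ` ?F" unfolding OPT_def using finF by (intro Max_in) auto
  then obtain T where T: "OPT N k0 f = f T" "T \<in> ?F" by (rule imageE)
  have opt: "f A \<le> f T" if "A \<in> ?F" for A
    unfolding T(1)[symmetric] OPT_def using finF that by (intro Max_ge) auto
  have finT: "finite T" using T(2) finite_ground finite_subset by blast
  have fin: "finite (singles N)" using finite_ground by (simp add: singles_def)
  define M where "M = Max (f ` singles N)"
  have M_ge: "f A \<le> M" if "A \<in> singles N" for A
    unfolding M_def using fin that by (intro Max_ge) auto
  have "M \<in> f ` singles N" unfolding M_def using fin by (intro Max_in) (auto simp: singles_def)
  then obtain A where A: "M = f A" "A \<in> singles N" by (rule imageE)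
  have "A \<in> ?F" using A(2) assms(2) by (auto simp: singles_def)
  then have M_le: "M \<le> f T" unfolding A(1) by (rule opt)
  have "0 \<le> f {}" by (rule nonneg) simp
  then have M0: "0 \<le> M" using M_ge[of "{}"] by (simp add: singles_def)
  have T_le: "f T \<le> k * M"
  proof (cases "T = {}")
    case True
    have "f T \<le> 1 * M" using M_ge[of "{}"] True by (simp add: singles_def)
    also have "\<dots> \<le> k * M" using k1 M0 by (intro mult_right_mono) auto
    finally show ?thesis .
  next
    case False
    have "f T \<le> (\<Sum>x\<in>T. f {x})" using T(2) False by (intro value_le_sum_singles) auto
    also have "\<dots> \<le> card T * M"
      using T(2) M_ge by (intro sum_bounded_above) (auto simp: singles_def)
    also have "\<dots> \<le> k * M" using cardF[OF T(2)] M0 by (intro mult_right_mono) auto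
    finally show ?thesis .
  qed
  define R where "R = 7 * bits (card N)"
  let ?run = "exec f (search N k (guesses k) (schedule R (10 * M / k)) (\<lambda>i. []))"
  have exec: "measure_pmf.expectation (exec f (parallel_alg N k0)) (\<lambda>(S, tr). f S) =
      measure_pmf.expectation ?run (\<lambda>(S, tr). f S)"
    unfolding exec_parallel_alg[OF assms(1)] integral_map_pmf k_def M_def R_def case_prod_unfold by simp
  have "f T \<le> 5.83 * measure_pmf.expectation ?run (\<lambda>(S, tr). f S)"
  proof (cases "M = 0")
    \<comment> \<open>For \<open>M = 0\<close> all thresholds vanish, but then OPT is at most
      \<open>k * M = 0\<close>.\<close>
    case True
    have "0 \<le> measure_pmf.expectation ?run (\<lambda>(S, tr). f S)"
    proof (rule integral_nonneg_AE)
      have "0 \<le> f S" if "(S, tr) \<in> set_pmf ?run" for S tr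
        using search_cost[OF _ _ that] by (intro nonneg) simp
      then show "AE p in measure_pmf ?run. 0 \<le> (case p of (S, tr) \<Rightarrow> f S)"
        by (auto simp: AE_measure_pmf_iff)
    qed
    then show ?thesis using T_le True by simp
  next
    case False
    then have "0 < M" using M0 by simp
    then obtain i where i: "i \<le> guesses k" "f T \<le> 2 ^ i * M" "2 ^ i * M \<le> 2 * f T"
      using ex_power_scale[OF _ M_le T_le k1] by blast
    define t where "t = 2 ^ i * (10 * M / k)"
    have kt: "k * t = 10 * (2 ^ i * M)" using k1 by (simp add: t_def)
    have "f T \<le> 5.83 * measure_pmf.expectation (rounds f N k (schedule R t) []) (\<lambda>h. f (kept h))"
      unfolding R_def
    proof (rule expectation_kept_ge)
      show "f A \<le> f T" if "A \<subseteq> T" for A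
        using that T(2) card_mono[OF finT that] by (intro opt) auto
      show "10 * f T \<le> k * t" "k * t \<le> 20 * f T" unfolding kt using i(2,3) by argo+
      show "0 < t" using \<open>0 < M\<close> k1 by (simp add: t_def)
      show "card N < 2 ^ bits (card N)" by (rule less_power_bits[OF n1])
    qed (use T(2) cardF in auto)
    also have "schedule R t = map ((*) (2 ^ i)) (schedule R (10 * M / k))"
      by (simp add: map_schedule t_def)
    also have "measure_pmf.expectation (rounds f N k \<dots> []) (\<lambda>h. f (kept h)) \<le>
        measure_pmf.expectation ?run (\<lambda>(S, tr). f S)"
      using expectation_search_ge[OF i(1), of k _ "\<lambda>i. []"] by simp
    finally show ?thesis by simp
  qed
  then show ?thesis unfolding T(1) exec .
qed

end

section \<open>Passage to the stated bounds\<close>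

lemma instance_of_locale:
  "instance_of N k f \<Longrightarrow> submodular_instance N f"
  by (auto simp: instance_of_def nonneg_on_def submodular_instance_def)

lemma parallel_alg_empty: "exec f (parallel_alg {} k) = return_pmf ({}, [])"
  by (simp add: parallel_alg_def)

lemma approximation_parallel_alg:
  assumes "5.83 \<le> \<beta>"
  shows "approximation_alg \<beta> (parallel_alg :: 'a subset_alg)"
  unfolding approximation_alg_def
proof (intro allI impI)
  fix N :: "'a set" and k f
  assume inst: "instance_of N k f"
  then interpret submodular_instance N f by (rule instance_of_locale)
  let ?E = "measure_pmf.expectation (exec f (parallel_alg N k)) (\<lambda>(S, tr). f S)"
  show "(\<forall>(S, tr)\<in>set_pmf (exec f (parallel_alg N k)). S \<subseteq> N \<and> card S \<le> k) \<and> OPT N k f \<le> \<beta> * ?E"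
  proof (cases "N = {}")
    case True
    have "{T. T = {} \<and> card T \<le> k} = {{} :: 'a set}" by auto
    then have "OPT N k f = f {}" by (simp add: True OPT_def)
    moreover have "1 * f {} \<le> \<beta> * f {}" using assms nonneg[of "{}"] by (intro mult_right_mono) auto
    ultimately show ?thesis by (simp add: True parallel_alg_empty)
  next
    case False
    have k: "1 \<le> k" using inst by (simp add: instance_of_def)
    have cost: "\<forall>(S, tr)\<in>set_pmf (exec f (parallel_alg N k)). S \<subseteq> N \<and> card S \<le> k"
      using parallel_alg_cost[OF False k] by blast
    have "0 \<le> ?E"
      using cost by (intro integral_nonneg_AE) (auto simp: AE_measure_pmf_iff intro!: nonneg)
    then have "5.83 * ?E \<le> \<beta> * ?E" using assms by (intro mult_right_mono)
    then show ?thesis using cost parallel_alg_approximates[OF False k] by simp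
  qed
qed

lemma parallel_alg_bounds:
  assumes "instance_of N k f" "(S, tr) \<in> set_pmf (exec f (parallel_alg N k))"
  shows "\<forall>qs\<in>set tr. set qs \<subseteq> Pow N"
    and "real (length tr) \<le> 3000 * lg (card N)"
    and "real (length (concat tr)) \<le> 300000 * (card N * lg (card N) * (lg (min k (card N)))\<^sup>2)"
proof -
  interpret submodular_instance N f using assms(1) by (rule instance_of_locale)
  have "(\<forall>qs\<in>set tr. set qs \<subseteq> Pow N) \<and> real (length tr) \<le> 3000 * lg (card N) \<and>
    real (length (concat tr)) \<le> 300000 * (card N * lg (card N) * (lg (min k (card N)))\<^sup>2)"
  proof (cases "N = {}")
    case True
    then show ?thesis using assms(2) lg_ge_1[of 0] by (simp add: parallel_alg_empty)
  next
    case False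
    then show ?thesis using parallel_alg_cost[OF False _ assms(2)] assms(1) by (simp add: instance_of_def)
  qed
  then show "\<forall>qs\<in>set tr. set qs \<subseteq> Pow N" "real (length tr) \<le> 3000 * lg (card N)"
    "real (length (concat tr)) \<le> 300000 * (card N * lg (card N) * (lg (min k (card N)))\<^sup>2)" by auto
qed

text \<open>The factor \<open>n\<close> covers \<open>n = 0\<close>, where \<open>lg_mono\<close>
  does not apply to the minimum.\<close>

lemma lg_min_le:
  assumes "1 \<le> k"
  shows "real n * (lg (min k n))\<^sup>2 \<le> real n * (lg k)\<^sup>2"
proof (cases "n = 0")
  case False
  have "lg (min k n) \<le> lg k" using False assms by (intro lg_mono) auto
  then show ?thesis using lg_ge_1[of "min k n"] by (intro mult_left_mono power_mono) auto
qed simp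

text \<open>Both logarithms are at most \<open>n\<close>, the one of \<open>min k n\<close> however
  large \<open>k\<close> is, which gives a bound of order \<open>n ^ 4\<close>.\<close>

lemma admissible_parallel_alg: "admissible_rounds (parallel_alg :: 'a subset_alg)"
  unfolding admissible_rounds_def
proof (intro exI[of _ "monom 300000 4"] allI impI ballI, clarify, intro conjI)
  fix N :: "'a set" and k f S tr qs
  assume inst: "instance_of N k f" and tr: "(S, tr) \<in> set_pmf (exec f (parallel_alg N k))"
    and qs: "qs \<in> set tr"
  note b = parallel_alg_bounds[OF inst tr]
  show "set qs \<subseteq> Pow N" using b(1) qs by auto
  define n where "n = card N"
  have "length qs \<le> length (concat tr)" using qs by (auto simp: length_concat intro: member_le_sum_list)
  then have "real (length qs) \<le> real (length (concat tr))" by (simp only: of_nat_le_iff)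
  also have "\<dots> \<le> 300000 * (n * lg n * (lg (min k n))\<^sup>2)" using b(3) by (simp add: n_def)
  also have "\<dots> \<le> 300000 * (real n * real n * (real n)\<^sup>2)"
  proof (cases "n = 0")
    case False
    have k: "1 \<le> k" using inst by (simp add: instance_of_def)
    have 1: "lg n \<le> n" using False by (intro lg_le_self) simp
    have "lg (min k n) \<le> lg n" using False k by (intro lg_mono) auto
    then have 2: "lg (min k n) \<le> n" using 1 by (rule order_trans)
    have "(lg (min k n))\<^sup>2 \<le> (real n)\<^sup>2" using 2 lg_ge_1[of "min k n"] by (intro power_mono) auto
    then have "real n * lg n * (lg (min k n))\<^sup>2 \<le> real n * real n * (real n)\<^sup>2"
      using 1 lg_ge_1[of n] by (intro mult_mono) auto
    then show ?thesis by simp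
  qed simp
  also have "\<dots> = poly (monom 300000 4) (real (card N))"
    by (simp add: poly_monom n_def power2_eq_square power4_eq_xxxx)
  finally show "real (length qs) \<le> poly (monom 300000 4) (real (card N))" .
qed

theorem theorem4:
  shows "(\<exists>C > 0. \<forall>\<epsilon>::real. 0 < \<epsilon> \<and> \<epsilon> < 2 / 5 \<longrightarrow>
           (\<exists>A :: 'a subset_alg.
              approximation_alg (5.83 + \<epsilon>) A \<and>
              admissible_rounds A \<and>
              adaptive_rounds_le A (\<lambda>n k. C * (1 / \<epsilon> * lg n)) \<and>
              value_queries_le A (\<lambda>n k. C * (n * k / \<epsilon> ^ 3 * lg n * lg k * lg (1 / \<epsilon>))))) \<and>
         (\<exists>C > 0. \<forall>\<epsilon>::real. 0 < \<epsilon> \<and> \<epsilon> < 2 / 5 \<longrightarrow>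
           (\<exists>A :: 'a subset_alg.
              approximation_alg (5.83 + \<epsilon>) A \<and>
              admissible_rounds A \<and>
              adaptive_rounds_le A (\<lambda>n k. C * (1 / \<epsilon> * lg n * lg k)) \<and>
              value_queries_le A (\<lambda>n k. C * (n / \<epsilon> ^ 3 * lg n * (lg k)\<^sup>2 * lg (1 / \<epsilon>)))))"
proof -
  \<comment> \<open>The algorithm does not depend on \<epsilon>. As \<epsilon> < 1, the factors in
    \<open>1 / \<epsilon>\<close> are at least 1 and only weaken its bounds.\<close>
  have main: "approximation_alg (5.83 + \<epsilon>) (parallel_alg :: 'a subset_alg)"
    "adaptive_rounds_le (parallel_alg :: 'a subset_alg) (\<lambda>n k. 300000 * (1 / \<epsilon> * lg n))"
    "adaptive_rounds_le (parallel_alg :: 'a subset_alg) (\<lambda>n k. 300000 * (1 / \<epsilon> * lg n * lg k))"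
    "value_queries_le (parallel_alg :: 'a subset_alg)
      (\<lambda>n k. 300000 * (n * k / \<epsilon> ^ 3 * lg n * lg k * lg (1 / \<epsilon>)))"
    "value_queries_le (parallel_alg :: 'a subset_alg)
      (\<lambda>n k. 300000 * (n / \<epsilon> ^ 3 * lg n * (lg k)\<^sup>2 * lg (1 / \<epsilon>)))"
    if \<epsilon>: "0 < \<epsilon> \<and> \<epsilon> < 2 / 5" for \<epsilon> :: real
  proof -
    have inv: "1 \<le> 1 / \<epsilon>" using \<epsilon> by simp
    have "\<epsilon> ^ 3 \<le> 1" using \<epsilon> by (intro power_le_one) auto
    then have "1 * 1 \<le> 1 / \<epsilon> ^ 3 * lg (1 / \<epsilon>)"
      using \<epsilon> lg_ge_1[of "1 / \<epsilon>"] by (intro mult_mono) auto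
    then have factor: "1 \<le> 1 / \<epsilon> ^ 3 * lg (1 / \<epsilon>)" by simp
    show "approximation_alg (5.83 + \<epsilon>) (parallel_alg :: 'a subset_alg)"
      using \<epsilon> by (intro approximation_parallel_alg) simp
    have r1: "3000 * lg n \<le> 300000 * (1 / \<epsilon> * lg n)" for n
    proof -
      have "1 * lg n \<le> 1 / \<epsilon> * lg n" using inv lg_ge_1[of n] by (intro mult_right_mono) auto
      then show ?thesis using lg_ge_1[of n] by linarith
    qed
    have r2: "300000 * (1 / \<epsilon> * lg n) \<le> 300000 * (1 / \<epsilon> * lg n * lg k)" for n k
    proof -
      have "1 / \<epsilon> * lg n * 1 \<le> 1 / \<epsilon> * lg n * lg k"
        using inv lg_ge_1[of n] lg_ge_1[of k] \<epsilon> by (intro mult_left_mono) auto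
      then show ?thesis by simp
    qed
    show "adaptive_rounds_le (parallel_alg :: 'a subset_alg) (\<lambda>n k. 300000 * (1 / \<epsilon> * lg n))"
      unfolding adaptive_rounds_le_def
      using order_trans[OF parallel_alg_bounds(2) r1] by blast
    then show "adaptive_rounds_le (parallel_alg :: 'a subset_alg) (\<lambda>n k. 300000 * (1 / \<epsilon> * lg n * lg k))"
      unfolding adaptive_rounds_le_def using order_trans[OF _ r2] by blast
    have q2: "300000 * (n * lg n * (lg (min k n))\<^sup>2) \<le>
        300000 * (n / \<epsilon> ^ 3 * lg n * (lg k)\<^sup>2 * lg (1 / \<epsilon>))" if k: "1 \<le> k" for n k :: nat
    proof -
      have "n * lg n * (lg (min k n))\<^sup>2 = lg n * (n * (lg (min k n))\<^sup>2)" by simp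
      also have "\<dots> \<le> lg n * (n * (lg k)\<^sup>2)"
        using lg_ge_1[of n] by (intro mult_left_mono lg_min_le k) auto
      also have "\<dots> * 1 \<le> lg n * (n * (lg k)\<^sup>2) * (1 / \<epsilon> ^ 3 * lg (1 / \<epsilon>))"
        using lg_ge_1[of n] factor by (intro mult_left_mono) auto
      also have "\<dots> = n / \<epsilon> ^ 3 * lg n * (lg k)\<^sup>2 * lg (1 / \<epsilon>)" by simp
      finally show ?thesis by simp
    qed
    \<comment> \<open>The first claim allows a factor \<open>k\<close> in place of one logarithm,
      and \<open>lg k \<le> k\<close>.\<close>
    have q1: "300000 * (n / \<epsilon> ^ 3 * lg n * (lg k)\<^sup>2 * lg (1 / \<epsilon>)) \<le>
        300000 * (real n * real k / \<epsilon> ^ 3 * lg n * lg k * lg (1 / \<epsilon>))" if k: "1 \<le> k" for n k :: nat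
    proof -
      have "(n * lg n * lg k * (1 / \<epsilon> ^ 3 * lg (1 / \<epsilon>))) * lg k \<le> (n * lg n * lg k * (1 / \<epsilon> ^ 3 * lg (1 / \<epsilon>))) * k"
        using lg_ge_1[of n] lg_ge_1[of k] lg_ge_1[of "1 / \<epsilon>"] \<epsilon>
        by (intro mult_left_mono lg_le_self k mult_nonneg_nonneg) auto
      then have "n / \<epsilon> ^ 3 * lg n * (lg k)\<^sup>2 * lg (1 / \<epsilon>) \<le> real n * real k / \<epsilon> ^ 3 * lg n * lg k * lg (1 / \<epsilon>)"
        by (simp add: power2_eq_square mult_ac)
      then show ?thesis by (rule mult_left_mono) simp
    qed
    have ge1: "1 \<le> k" if "instance_of N k f" for N :: "'a set" and k f
      using that by (simp add: instance_of_def)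
    show v: "value_queries_le (parallel_alg :: 'a subset_alg)
      (\<lambda>n k. 300000 * (n / \<epsilon> ^ 3 * lg n * (lg k)\<^sup>2 * lg (1 / \<epsilon>)))"
      unfolding value_queries_le_def
      using order_trans[OF parallel_alg_bounds(3) q2[OF ge1]] by blast
    then show "value_queries_le (parallel_alg :: 'a subset_alg)
      (\<lambda>n k. 300000 * (n * k / \<epsilon> ^ 3 * lg n * lg k * lg (1 / \<epsilon>)))"
      unfolding value_queries_le_def using order_trans[OF _ q1[OF ge1]] by blast
  qed
  show ?thesis
    by (intro conjI exI[of _ 300000] allI impI exI[of _ parallel_alg] main admissible_parallel_alg) simp_all
qed

end
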